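(* Let $\{f_\iota\}_{\iota\in I}$ be a size-stable family, with limiting size $\sigma>0$, of additive character polynomials over fields $\{\mathbb{F}_{q_\iota}\}_{\iota\in I}$. (i) As $q_\iota\to\infty$, $\|f_\iota\|_4^4/\|f_\iota\|_2^4 \to -\frac{2}{3}\sigma+2\,\Omega\!\left(\frac{1}{\sigma},0\right)$. (ii) The function $\sigma\mapsto -\frac{2}{3}\sigma+2\,\Omega(1/\sigma,0)$ on $\sigma>0$ is globally minimized if and only if $\sigma$ is the unique root in $(1,1+\frac{9}{64})$ of $x^3-12x+12$.
   Context: An additive character polynomial over $\mathbb{F}_q$ is $f(z)=\sum_{j\in S}\psi(\alpha(j+t))z^j$, where $\psi:\mathbb{F}_q\to\mathbb{C}$ is a nontrivial additive character, the support $S=\{0,1,\ldots,s-1\}$ for some $s\ge1$, the translation $t\in\mathbb{Z}$, and the arrangement $\alpha$ is a group epimorphism from $(\mathbb{Z},+)$ onto $\mathbb{F}_q^*$. A family $\{f_\iota\}_{\iota\in I}$ of additive character polynomials, with $f_\iota$ over $\mathbb{F}_{q_\iota}$ with support $S_\iota$, is size-stable with limiting size $\sigma>0$ if $\{q_\iota:\iota\in I\}$ is infinite and $|S_\iota|/(q_\iota-1)\to\sigma$ as $q_\iota\to\infty$. For a univariate polynomial, $\|f\|_r=\left(\frac{1}{2\pi}\int_0^{2\pi}|f(e^{i\theta})|^r d\theta\right)^{1/r}$. For real $x\neq0$ and real $y$, $\Omega(x,y)=\sum_{n\in\mathbb{Z}}\max(0,1-|xn-y|)^2$. *)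

theory Defs
  imports
    "HOL-Analysis.Analysis"
    "HOL-Computational_Algebra.Polynomial"
    "HOL-Algebra.Ring"
    "HOL-Algebra.Elementary_Groups"
begin

definition complex_units :: "complex monoid" where
  "complex_units = \<lparr>carrier = UNIV - {0}, monoid.mult = (*), one = 1\<rparr>"

definition finite_field :: "('a, 'm) ring_scheme \<Rightarrow> bool" where
  "finite_field F \<longleftrightarrow> field F \<and> finite (carrier F)"

definition additive_character :: "('a, 'm) ring_scheme \<Rightarrow> ('a \<Rightarrow> complex) \<Rightarrow> bool" where
  "additive_character F \<psi> \<longleftrightarrow> \<psi> \<in> hom (add_monoid F) complex_units"

definition nontrivial_additive_character ::
    "('a, 'm) ring_scheme \<Rightarrow> ('a \<Rightarrow> complex) \<Rightarrow> bool" where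
  "nontrivial_additive_character F \<psi> \<longleftrightarrow>
     additive_character F \<psi> \<and> (\<exists>x\<in>carrier F. \<psi> x \<noteq> 1)"

definition additive_character_polynomial ::
    "('a, 'm) ring_scheme \<Rightarrow> nat set \<Rightarrow> complex poly \<Rightarrow> bool" where
  "additive_character_polynomial F S f \<longleftrightarrow>
     finite_field F \<and>
     (\<exists>s\<ge>1. S = {..<s}) \<and>
     (\<exists>\<psi> (t :: int) \<alpha>.
        nontrivial_additive_character F \<psi> \<and>
        \<alpha> \<in> epi integer_group (units_of F) \<and>
        f = (\<Sum>j\<in>S. Polynomial.monom (\<psi> (\<alpha> (int j + t))) j))"

text \<open>The filter on the index set \<open>I\<close> describing the passage \<open>q \<iota> \<longrightarrow> \<infinity>\<close>:
  a property holds eventually iff it holds for all \<open>\<iota> \<in> I\<close> with \<open>q \<iota>\<close> sufficiently large.\<close>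

definition size_to_infinity :: "'i set \<Rightarrow> ('i \<Rightarrow> nat) \<Rightarrow> 'i filter" where
  "size_to_infinity I q = inf (filtercomap q at_top) (principal I)"

definition size_stable ::
    "'i set \<Rightarrow> ('i \<Rightarrow> ('a, 'm) ring_scheme) \<Rightarrow> ('i \<Rightarrow> nat set) \<Rightarrow> real \<Rightarrow> bool" where
  "size_stable I F S \<sigma> \<longleftrightarrow>
     \<sigma> > 0 \<and>
     infinite ((\<lambda>\<iota>. card (carrier (F \<iota>))) ` I) \<and>
     ((\<lambda>\<iota>. real (card (S \<iota>)) / (real (card (carrier (F \<iota>))) - 1)) \<longlongrightarrow> \<sigma>)
       (size_to_infinity I (\<lambda>\<iota>. card (carrier (F \<iota>))))"

definition circle_norm :: "real \<Rightarrow> complex poly \<Rightarrow> real" where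
  "circle_norm r f =
     (1 / (2 * pi) * integral {0..2 * pi} (\<lambda>\<theta>. cmod (poly f (cis \<theta>)) powr r)) powr (1 / r)"

text \<open>For \<open>x \<noteq> 0\<close> only finitely many terms of the sum are nonzero.\<close>

definition Omega :: "real \<Rightarrow> real \<Rightarrow> real" where
  "Omega x y = (\<Sum>\<^sub>\<infinity>n::int. (max 0 (1 - \<bar>x * of_int n - y\<bar>))\<^sup>2)"

definition limit_ratio :: "real \<Rightarrow> real" where
  "limit_ratio \<sigma> = - (2 / 3) * \<sigma> + 2 * Omega (1 / \<sigma>) 0"

end

theory Submission
  imports
    Defs
    "HOL-Library.Real_Mod"
    "HOL-Algebra.Multiplicative_Group"
    "HOL-Real_Asymp.Real_Asymp"
begin

text \<open>
  Put \<open>N = q - 1\<close> and \<open>u a = \<psi> (\<alpha> (a + t))\<close>. The fourth power of the \<open>L\<^sup>4\<close> norm of \<open>f\<close> is the sum of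
  \<open>u a * u b * cnj (u c) * cnj (u d)\<close> over the quadruples from the support with \<open>a + b = c + d\<close>.
  With \<open>m = c - a\<close> the summand is \<open>\<psi>\<close> evaluated at \<open>\<alpha> t * (1 - \<alpha> m) * (\<alpha> a - \<alpha> d)\<close>, an \<open>N\<close>-periodic
  function of \<open>(a, d, m)\<close>. It equals 1 when \<open>N\<close> divides \<open>m\<close> or \<open>a - d\<close>, and elsewhere it is \<open>-1/N\<close> on
  average; after subtracting these parts, every Fourier coefficient modulo \<open>N\<close> is built from Gauss
  and Jacobi sums and has size at most \<open>q powr (3/2)\<close>. The Fourier coefficients of the region
  \<open>a + b = c + d\<close> have normalised \<open>L\<^sup>1\<close> norm bounded by a power of \<open>ln N\<close>, so the
  remainder is negligible against \<open>s\<^sup>2\<close>. The two subtracted indicator functions contribute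
  \<open>s\<^sup>2 * Omega (N / s) 0\<close> each, and the approximately \<open>2 / 3 * s ^ 3\<close> quadruples weighted by \<open>-1/N\<close>
  give the term \<open>- 2 / 3 * \<sigma>\<close>.

  The limit is \<open>2 - 2 / 3 * x\<close> for \<open>x \<le> 1\<close>; on \<open>[1, 2]\<close> its derivative has the sign of
  \<open>- (x ^ 3 - 12 * x + 12)\<close>; and for \<open>x \<ge> 2\<close> it is at least its value \<open>4 / 3\<close> at \<open>1\<close>.
\<close>

section \<open>The limiting ratio\<close>

text \<open>A term with \<open>\<bar>n\<bar> > K\<close> has
  \<open>x * \<bar>n\<bar> \<ge> 1\<close> and vanishes. Any sufficiently large \<open>K\<close> is
  allowed, so that one range of summation can serve a whole neighbourhood of
  \<open>x\<close>.\<close>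

lemma Omega_eq_finite_sum:
  assumes "x > 0" "1 \<le> x * (of_int K + 1)"
  shows "Omega x 0 = (\<Sum>n\<in>{-K..K}. (max 0 (1 - x * of_int \<bar>n\<bar>))\<^sup>2)"
proof -
  have "Omega x 0 = (\<Sum>\<^sub>\<infinity>n\<in>{-K..K}. (max 0 (1 - x * of_int \<bar>n\<bar>))\<^sup>2)"
    unfolding Omega_def
  proof (rule infsum_cong_neutral)
    fix n :: int assume "n \<in> UNIV - {-K..K}"
    then have "K + 1 \<le> \<bar>n\<bar>" by auto
    then have "real_of_int (K + 1) \<le> of_int \<bar>n\<bar>" unfolding of_int_le_iff .
    then have "x * (of_int K + 1) \<le> x * of_int \<bar>n\<bar>" using assms(1) by simp
    also have "\<dots> = \<bar>x * of_int n\<bar>" using assms(1) by (simp add: abs_mult)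
    finally show "(max 0 (1 - \<bar>x * of_int n - 0\<bar>))\<^sup>2 = 0" using assms(2) by simp
  qed (use assms in \<open>auto simp: abs_mult\<close>)
  then show ?thesis by simp
qed

lemma limit_ratio_le_1: "0 < x \<Longrightarrow> x \<le> 1 \<Longrightarrow> limit_ratio x = 2 - 2 / 3 * x"
  unfolding limit_ratio_def by (subst Omega_eq_finite_sum[where K = 0]) (auto simp: field_simps)

lemma limit_ratio_1_2:
  assumes "1 \<le> x" "x \<le> 2" shows "limit_ratio x = 2 - 2 / 3 * x + 4 * (1 - 1 / x)\<^sup>2"
proof -
  have "{-1..1::int} = {-1, 0, 1}" by auto
  then show ?thesis
    unfolding limit_ratio_def using assms by (subst Omega_eq_finite_sum[where K = 1]) (auto simp: field_simps max_def)
qed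

text \<open>Once \<open>Omega (1 / x) 0 \<ge> 2 / 3 * x\<close> is known, the ratio is at least
  \<open>2 / 3 * x\<close>. The bound 4/3 is the value at 1, so nothing finer is needed beyond
  2.\<close>

lemma limit_ratio_ge_2:
  assumes "2 \<le> x" shows "4 / 3 \<le> limit_ratio x"
proof -
  define k where "k = nat \<lfloor>x\<rfloor>"
  define r where "r = x - k"
  have k: "real k \<le> x" "x < real k + 1" "k \<ge> 2" using assms unfolding k_def by linarith+
  then have r: "0 \<le> r" "r \<le> 1" by (auto simp: r_def)
  \<comment> \<open>Without the truncation by \<open>max\<close> this is a sum of squares in
    arithmetic progression. The truncation is inactive for \<open>\<bar>n\<bar> \<le> x\<close>,
    hence the choice of \<open>k\<close> as the integer part of \<open>x\<close>.\<close>
  have closed: "(\<Sum>n\<in>{-int k..int k}. (1 - 1 / x * of_int \<bar>n\<bar>)\<^sup>2)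
     = 1 + 2 * (real k - real k * (real k + 1) / x + real k * (real k + 1) * (2 * real k + 1) / (6 * x\<^sup>2))" for k
  proof (induction k)
    case (Suc k)
    have "{-int (Suc k)..int (Suc k)} = insert (- int (Suc k)) (insert (int (Suc k)) {-int k..int k})" by auto
    then have "(\<Sum>n\<in>{-int (Suc k)..int (Suc k)}. (1 - 1 / x * of_int \<bar>n\<bar>)\<^sup>2)
       = (\<Sum>n\<in>{-int k..int k}. (1 - 1 / x * of_int \<bar>n\<bar>)\<^sup>2) + 2 * (1 - 1 / x * (k + 1))\<^sup>2"
      by (simp add: add.commute)
    also have "\<dots> = 1 + 2 * (real (Suc k) - real (Suc k) * (real (Suc k) + 1) / x
        + real (Suc k) * (real (Suc k) + 1) * (2 * real (Suc k) + 1) / (6 * x\<^sup>2))"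
      unfolding Suc using assms by (simp add: field_simps power2_eq_square)
    finally show ?case .
  qed simp
  have "Omega (1 / x) 0 = (\<Sum>n\<in>{-int k..int k}. (max 0 (1 - 1 / x * of_int \<bar>n\<bar>))\<^sup>2)"
    using assms k by (intro Omega_eq_finite_sum) (auto simp: field_simps)
  also have "\<dots> = (\<Sum>n\<in>{-int k..int k}. (1 - 1 / x * of_int \<bar>n\<bar>)\<^sup>2)"
  proof (intro sum.cong refl)
    fix n assume "n \<in> {-int k..int k}"
    then have "real_of_int \<bar>n\<bar> \<le> x" using k by (auto intro: order_trans[of _ "real k"])
    then show "(max 0 (1 - 1 / x * of_int \<bar>n\<bar>))\<^sup>2 = (1 - 1 / x * of_int \<bar>n\<bar>)\<^sup>2"
      using assms by (simp add: max_def field_simps)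
  qed
  finally have Om: "Omega (1 / x) 0 = 1 + 2 * (real k - real k * (real k + 1) / x + real k * (real k + 1) * (2 * real k + 1) / (6 * x\<^sup>2))"
    unfolding closed .
  txt \<open>The sum defining \<open>Omega\<close> exceeds \<open>2 / 3 * x\<close>, the integral of its convex summand, as by the
    trapezoidal rule.\<close>
  have "r\<^sup>2 * r \<le> r\<^sup>2 * 1" using r by (intro mult_left_mono) auto
  moreover have "r\<^sup>2 * r = r ^ 3" by (simp add: power2_eq_square power3_eq_cube)
  ultimately have "0 \<le> k + 3 * r\<^sup>2 - 2 * r ^ 3" using zero_le_power2[of r] by linarith
  also have "k + 3 * r\<^sup>2 - 2 * r ^ 3 = 3 * x\<^sup>2 * (Omega (1 / x) 0 - 2 / 3 * x)"
    using assms unfolding Om r_def by (simp add: field_simps power2_eq_square power3_eq_cube)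
  finally have "2 / 3 * x \<le> Omega (1 / x) 0"
    using assms by (simp add: zero_le_mult_iff)
  then show ?thesis using assms by (simp add: limit_ratio_def)
qed

section \<open>The cubic and the minimiser of the limiting ratio\<close>

lemma cubic_strict_decreasing:
  fixes x y :: real
  assumes "1 \<le> x" "x < y" "y \<le> 1 + 9/64"
  shows "y ^ 3 - 12 * y + 12 < x ^ 3 - 12 * x + 12"
proof -
  \<comment> \<open>The difference of the two cubics is \<open>y - x\<close> times
    \<open>x^2 + x * y + y^2 - 12\<close>; both arguments lie below 2, so the quadratic form stays
    below 12.\<close>
  have "x\<^sup>2 + x * y + y\<^sup>2 \<le> 2 * 2 + 2 * 2 + 2 * 2" unfolding power2_eq_square using assms by (intro add_mono mult_mono) auto
  moreover have "x * x < 2 * 2" using assms by (intro mult_strict_mono) auto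
  ultimately have "x\<^sup>2 + x * y + y\<^sup>2 < 12"
    using assms mult_mono[of x 2 y 2] mult_mono[of y 2 y 2] by (simp add: power2_eq_square)
  then have "(y - x) * (x\<^sup>2 + x * y + y\<^sup>2 - 12) < 0" using assms by (intro mult_pos_neg) auto
  then show ?thesis by (simp add: algebra_simps power2_eq_square power3_eq_cube)
qed

lemma cubic_root_unique:
  fixes y z :: real
  assumes "y \<in> {1<..<1 + 9/64}" "y ^ 3 - 12 * y + 12 = 0"
    and "z \<in> {1<..<1 + 9/64}" "z ^ 3 - 12 * z + 12 = 0"
  shows "y = z"
  using cubic_strict_decreasing[of y z] cubic_strict_decreasing[of z y] assms
  by (cases y z rule: linorder_cases) auto

text \<open>The cubic is 1 at the left end and negative at the right end. The intermediate value
  theorem yields a root in the closed interval, so the two ends are excluded separately.\<close>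

lemma cubic_unique_root: "\<exists>!x::real. x \<in> {1<..<1 + 9/64} \<and> x ^ 3 - 12 * x + 12 = 0"
proof -
  let ?p = "\<lambda>x::real. x ^ 3 - 12 * x + 12"
  have "\<exists>x. 1 \<le> x \<and> x \<le> 1 + 9/64 \<and> ?p x = 0"
    by (rule IVT2') (auto intro!: continuous_intros simp: power3_eq_cube)
  then obtain x where x: "1 \<le> x" "x \<le> 1 + 9/64" "?p x = 0" by blast
  moreover have "?p 1 \<noteq> 0" "?p (1 + 9/64) \<noteq> 0" by (simp_all add: power3_eq_cube)
  ultimately have "x \<noteq> 1" "x \<noteq> 1 + 9/64" by metis+
  with x have "x \<in> {1<..<1 + 9/64} \<and> ?p x = 0" by auto
  then show ?thesis using cubic_root_unique by blast
qed

text \<open>For all \<open>y > x / 2\<close> the terms with \<open>\<bar>n\<bar> > k\<close>, where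
  \<open>k > 2 / x\<close>, vanish. Near \<open>x\<close> the series is therefore one fixed finite
  sum of continuous functions.\<close>

lemma isCont_Omega:
  assumes "x > 0" shows "isCont (\<lambda>x. Omega x 0) x"
proof -
  obtain k :: nat where k: "2 / x < of_nat k" using reals_Archimedean2 by blast
  let ?f = "\<lambda>y. \<Sum>n\<in>{-int k..int k}. (max 0 (1 - y * of_int \<bar>n\<bar>))\<^sup>2"
  have "\<forall>\<^sub>F y in nhds x. y \<in> {x / 2<..}" using assms by (intro eventually_nhds_in_open) auto
  then have "\<forall>\<^sub>F y in nhds x. Omega y 0 = ?f y"
  proof eventually_elim
    case (elim y)
    have "1 \<le> x / 2 * (of_int (int k) + 1)" using k assms by (simp add: field_simps)
    also have "\<dots> \<le> y * (of_int (int k) + 1)" using elim by (intro mult_right_mono) auto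
    finally show ?case using elim assms by (intro Omega_eq_finite_sum) auto
  qed
  then show ?thesis
    by (subst isCont_cong) (auto intro!: continuous_intros)
qed

text \<open>On \<open>[1, 2]\<close> the difference of the two values is computed outright: the
  equation for \<open>x\<close> makes it a positive multiple of
  \<open>(y - x)^2 * (6 - x^2 * y)\<close>. Elsewhere the comparison passes through the value 4/3 at
  1.\<close>

lemma limit_ratio_less:
  assumes x: "x \<in> {1<..<1 + 9/64}" "x ^ 3 - 12 * x + 12 = 0" and y: "y > 0" "y \<noteq> x"
  shows "limit_ratio x < limit_ratio y"
proof -
  have mid: "limit_ratio x < limit_ratio y" if "1 \<le> y" "y \<le> 2" "y \<noteq> x" for y
  proof -
    have "x\<^sup>2 * y \<le> (3/2 * (3/2)) * 2" unfolding power2_eq_square using x that by (intro mult_mono) auto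
    then have "0 < (y - x)\<^sup>2 * (6 - x\<^sup>2 * y) * 2" using that by simp
    also have "\<dots> = 3 * x\<^sup>2 * y\<^sup>2 * (limit_ratio y - limit_ratio x)"
    proof -
      have "3 * x\<^sup>2 * y\<^sup>2 * (limit_ratio y - limit_ratio x)
        = 2 * (y - x) * (6 * (2 * x * y - x - y) - x\<^sup>2 * y\<^sup>2)"
        using x(1) that by (simp add: limit_ratio_1_2 field_simps power2_eq_square)
      \<comment> \<open>A multiple of the cubic in \<open>x\<close> is split off; what remains has a
        second factor \<open>y - x\<close>, which produces the square.\<close>
      also have "\<dots> = 2 * (y - x) * ((y - x) * (12 * x - 6 - x ^ 3 - x\<^sup>2 * y) - x * (x ^ 3 - 12 * x + 12))"
        by (simp add: algebra_simps power2_eq_square power3_eq_cube)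
      also have "12 * x - 6 - x ^ 3 - x\<^sup>2 * y = 6 - x\<^sup>2 * y" using x(2) by simp
      also have "2 * (y - x) * ((y - x) * (6 - x\<^sup>2 * y) - x * (x ^ 3 - 12 * x + 12)) = (y - x)\<^sup>2 * (6 - x\<^sup>2 * y) * 2"
        unfolding x(2) by (simp add: algebra_simps power2_eq_square)
      finally show ?thesis by (rule sym)
    qed
    finally have "0 < 3 * x\<^sup>2 * y\<^sup>2 * (limit_ratio y - limit_ratio x)" .
    moreover have "0 < 3 * x\<^sup>2 * y\<^sup>2" using x(1) that by simp
    ultimately have "0 < limit_ratio y - limit_ratio x" by (rule zero_less_mult_pos)
    then show ?thesis by simp
  qed
  have "limit_ratio x < 4 / 3"
    using mid[of 1] x(1) by (simp add: limit_ratio_le_1)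
  moreover have "4 / 3 \<le> limit_ratio y" if "y \<le> 1 \<or> 2 \<le> y"
    using that y limit_ratio_ge_2[of y] by (auto simp: limit_ratio_le_1)
  ultimately show ?thesis using mid[of y] y(2) by (cases "y \<le> 1 \<or> 2 \<le> y") auto
qed

lemma is_arg_min_limit_ratio_iff:
  "is_arg_min limit_ratio (\<lambda>\<tau>. \<tau> > 0) x \<longleftrightarrow> x \<in> {1<..<1 + 9/64} \<and> x ^ 3 - 12 * x + 12 = 0"
proof -
  obtain z :: real where z: "z \<in> {1<..<1 + 9/64}" "z ^ 3 - 12 * z + 12 = 0"
    using cubic_unique_root by blast
  have "is_arg_min limit_ratio (\<lambda>\<tau>. \<tau> > 0) x \<longleftrightarrow> x = z"
  proof
    assume "is_arg_min limit_ratio (\<lambda>\<tau>. \<tau> > 0) x"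
    then have "x > 0" "\<not> limit_ratio z < limit_ratio x" using z(1) by (simp_all add: is_arg_min_def)
    then show "x = z" using limit_ratio_less[OF z, of x] by blast
  next
    assume "x = z"
    have "\<not> limit_ratio y < limit_ratio z" if "y > 0" for y
      using limit_ratio_less[OF z that] by (cases "y = z") auto
    then show "is_arg_min limit_ratio (\<lambda>\<tau>. \<tau> > 0) x"
      using z(1) \<open>x = z\<close> by (auto simp: is_arg_min_def)
  qed
  also have "\<dots> \<longleftrightarrow> x \<in> {1<..<1 + 9/64} \<and> x ^ 3 - 12 * x + 12 = 0"
  proof
    assume "x \<in> {1<..<1 + 9/64} \<and> x ^ 3 - 12 * x + 12 = 0"
    then show "x = z" using cubic_root_unique z by simp
  qed (use z in simp)
  finally show ?thesis .
qed

section \<open>Finite Fourier analysis on the integers\<close>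

text \<open>The modulus is an argument because characters modulo \<open>N\<close> and modulo a
  multiple of \<open>N\<close> occur together.\<close>

definition root_char :: "int \<Rightarrow> int \<Rightarrow> complex" where
  "root_char N x = cis (2 * pi * of_int x / of_int N)"

lemma root_char_add: "root_char N (x + y) = root_char N x * root_char N y"
  by (simp add: root_char_def cis_mult ring_distribs add_divide_distrib)

lemma root_char_0 [simp]: "root_char N 0 = 1"
  by (simp add: root_char_def)

lemma norm_root_char [simp]: "norm (root_char N x) = 1"
  by (simp add: root_char_def)

lemma cnj_root_char: "cnj (root_char N x) = root_char N (- x)"
  by (simp add: root_char_def cis_cnj)

lemma root_char_eq_1_iff:
  assumes "N > 0" shows "root_char N x = 1 \<longleftrightarrow> N dvd x"
proof -
  have "root_char N x = 1 \<longleftrightarrow> (\<exists>n. real_of_int x = real_of_int n * real_of_int N)"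
    using assms by (simp add: root_char_def cis_eq_1_iff field_simps)
  also have "\<dots> \<longleftrightarrow> (\<exists>n. x = n * N)"
    by (simp flip: of_int_mult)
  finally show ?thesis by (auto simp: dvd_def mult.commute)
qed

lemma root_char_cong:
  assumes "N > 0" "N dvd x - y" shows "root_char N x = root_char N y"
  using root_char_add[of N "x - y" y] root_char_eq_1_iff[of N "x - y"] assms by simp

lemma root_char_mult_cancel:
  assumes "K > 0" shows "root_char (K * N) (K * x) = root_char N x"
  using assms by (simp add: root_char_def mult.assoc)

text \<open>Translation permutes the residues modulo \<open>N\<close>. This is the change of
  variable behind most of the character sums below.\<close>

lemma sum_residues_shift:
  fixes f :: "int \<Rightarrow> 'b::comm_monoid_add"
  assumes "N > 0" and per: "\<And>x y. N dvd x - y \<Longrightarrow> f x = f y"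
  shows "(\<Sum>x\<in>{0..<N}. f (x + c)) = (\<Sum>x\<in>{0..<N}. f x)"
proof (rule sum.reindex_bij_witness[where i = "\<lambda>x. (x - c) mod N" and j = "\<lambda>x. (x + c) mod N"])
  fix x assume "x \<in> {0..<N}"
  then show "((x + c) mod N - c) mod N = x" "((x - c) mod N + c) mod N = x"
    by (simp_all add: mod_simps)
  show "(x + c) mod N \<in> {0..<N}" "(x - c) mod N \<in> {0..<N}" using assms(1) by simp_all
  show "f ((x + c) mod N) = f (x + c)"
    by (rule per) (metis dvd_minus_mod dvd_minus_iff minus_diff_eq)
qed

text \<open>Shifting the summation by 1 multiplies the sum by \<open>root_char N k\<close>, which
  differs from 1 unless \<open>N\<close> divides \<open>k\<close>.\<close>

lemma sum_root_char:
  assumes "N > 0"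
  shows "(\<Sum>x\<in>{0..<N}. root_char N (k * x)) = (if N dvd k then of_int N else 0)"
proof (cases "N dvd k")
  case True
  then have "root_char N (k * x) = 1" for x
    using assms by (simp add: root_char_eq_1_iff)
  then show ?thesis using True assms by simp
next
  case False
  let ?S = "\<Sum>x\<in>{0..<N}. root_char N (k * x)"
  have "(\<Sum>x\<in>{0..<N}. root_char N (k * (x + 1))) = ?S"
    by (rule sum_residues_shift[OF assms])
       (intro root_char_cong[OF assms], simp flip: right_diff_distrib)
  then have "root_char N k * ?S = ?S"
    by (simp add: distrib_left root_char_add sum_distrib_left mult.commute)
  then have "(root_char N k - 1) * ?S = 0" by (simp add: algebra_simps)
  then show ?thesis using False root_char_eq_1_iff[OF assms] by auto
qed

lemma sum_root_char':
  assumes "N > 0"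
  shows "(\<Sum>x\<in>{0..<N}. root_char N (- (k * x))) = (if N dvd k then of_int N else 0)"
  using sum_root_char[OF assms, of "- k"] by simp

text \<open>Orthogonality of characters leaves only the residue of \<open>x\<close>. The
  coefficients are unnormalised, whence the factor \<open>N\<close>.\<close>

lemma fourier_inversion:
  assumes "N > 0" and per: "\<And>x y. N dvd x - y \<Longrightarrow> f x = f y"
  shows "of_int N * f x =
    (\<Sum>k\<in>{0..<N}. (\<Sum>y\<in>{0..<N}. f y * root_char N (- (k * y))) * root_char N (k * x))"
proof -
  have "(\<Sum>k\<in>{0..<N}. (\<Sum>y\<in>{0..<N}. f y * root_char N (- (k * y))) * root_char N (k * x)) =
     (\<Sum>y\<in>{0..<N}. f y * (\<Sum>k\<in>{0..<N}. root_char N ((x - y) * k)))"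
    unfolding sum_distrib_left sum_distrib_right
    by (subst sum.swap, intro sum.cong refl)
       (simp add: algebra_simps flip: root_char_add)
  also have "\<dots> = (\<Sum>y\<in>{0..<N}. if y = x mod N then of_int N * f x else 0)"
  proof (intro sum.cong refl)
    fix y assume y: "y \<in> {0..<N}"
    have "N dvd x - y \<longleftrightarrow> y = x mod N"
      using y by (auto simp: mod_eq_dvd_iff[symmetric])
    then show "f y * (\<Sum>k\<in>{0..<N}. root_char N ((x - y) * k)) = (if y = x mod N then of_int N * f x else 0)"
      using per[of x y] by (auto simp: sum_root_char[OF assms(1)])
  qed
  also have "\<dots> = of_int N * f x" using assms(1) by simp
  finally show ?thesis by simp
qed

section \<open>Dirichlet kernels\<close>

text \<open>Concavity of sine gives Jordan's inequality on the first half, and reflection gives the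
  other half. The product \<open>x * (1 - x)\<close> is convenient because its reciprocal is
  \<open>1 / x + 1 / (1 - x)\<close>, which leads to harmonic sums.\<close>

lemma sin_pi_ge:
  fixes x :: real
  assumes "0 \<le> x" "x \<le> 1"
  shows "2 * x * (1 - x) \<le> sin (pi * x)"
proof -
  have jordan: "2 * x \<le> sin (pi * x)" if "0 \<le> x" "x \<le> 1/2" for x :: real
  proof -
    have "concave_on {0..pi/2} sin"
      by (rule f''_le0_imp_concave[where f' = cos and f'' = "\<lambda>x. - sin x"])
         (auto intro!: derivative_eq_intros sin_ge_zero)
    from concave_onD[OF this, of "2 * x" 0 "pi / 2"] that show ?thesis
      by (simp add: mult.commute)
  qed
  have upper: "2 * x * (1 - x) \<le> 2 * x" "2 * x * (1 - x) \<le> 2 * (1 - x)"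
    using assms mult_left_le_one_le[of "1 - x" x] mult_left_le_one_le[of x "1 - x"]
    by (simp_all add: algebra_simps)
  have "sin (pi * (1 - x)) = sin (pi * x)"
    by (simp add: right_diff_distrib)
  then show ?thesis
    using jordan[of x] jordan[of "1 - x"] upper assms by (cases "x \<le> 1/2") auto
qed

lemma norm_root_char_minus_1:
  "norm (root_char M y - 1) = 2 * \<bar>sin (pi * of_int y / of_int M)\<bar>"
proof -
  let ?t = "pi * of_int y / of_int M :: real"
  have "root_char M y = cis ?t * cis ?t"
    by (simp add: root_char_def cis_mult mult.assoc)
  then have "root_char M y - 1 = cis ?t * (cis ?t - cis (- ?t))"
    by (simp add: algebra_simps cis_mult)
  also have "cis ?t - cis (- ?t) = 2 * \<i> * sin ?t"
    by (simp add: complex_eq_iff)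
  finally show ?thesis by (simp add: norm_mult)
qed

definition dirichlet_sum :: "int \<Rightarrow> int \<Rightarrow> int \<Rightarrow> complex" where
  "dirichlet_sum M s y = (\<Sum>a\<in>{0..<s}. root_char M (y * a))"

lemma dirichlet_sum_cong:
  assumes "M > 0" "M dvd x - y" shows "dirichlet_sum M s x = dirichlet_sum M s y"
  unfolding dirichlet_sum_def
  by (intro sum.cong refl root_char_cong[OF assms(1)]) (simp add: assms(2) flip: left_diff_distrib)

lemma norm_dirichlet_sum_le:
  assumes "s \<ge> 0" shows "norm (dirichlet_sum M s y) \<le> of_int s"
  unfolding dirichlet_sum_def using assms by (intro sum_norm_le[THEN order_trans]) auto

text \<open>Multiplying the geometric sum by \<open>root_char M y - 1\<close> makes it telescope.
  The product form avoids division where the sine vanishes.\<close>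

lemma norm_dirichlet_sum_mult_le:
  assumes "s \<ge> 0"
  shows "norm (dirichlet_sum M s y) * \<bar>sin (pi * of_int y / of_int M)\<bar> \<le> 1"
proof -
  let ?e = "\<lambda>a. root_char M (y * a)"
  have tele: "(\<Sum>a\<in>{0..<s}. ?e (a + 1) - ?e a) = ?e s - 1" using assms
  proof (induction s rule: int_ge_induct)
    case (step i)
    have "{0..<i + 1} = insert i {0..<i}" using step.hyps by auto
    then show ?case using step by simp
  qed simp
  have "dirichlet_sum M s y * (root_char M y - 1) = (\<Sum>a\<in>{0..<s}. ?e (a + 1) - ?e a)"
    unfolding dirichlet_sum_def sum_distrib_right
    by (intro sum.cong refl) (simp add: algebra_simps root_char_add)
  also note tele
  finally have "norm (dirichlet_sum M s y) * norm (root_char M y - 1) = norm (?e s - 1)"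
    by (metis norm_mult)
  also have "\<dots> \<le> 2"
    by (rule norm_triangle_ineq4[THEN order_trans]) simp
  finally show ?thesis by (simp add: norm_root_char_minus_1)
qed

text \<open>The points \<open>(x + K * k) / (K * N)\<close> are spaced \<open>1 / N\<close> apart on
  the circle. The two that may be closest to 0 receive the trivial bound \<open>s\<close>; the
  others are at distances comparable with \<open>k / N\<close> and give a harmonic sum.\<close>

lemma sum_norm_dirichlet_sum_le:
  assumes "N > 0" "K > 0" "s \<ge> 0"
  shows "(\<Sum>k\<in>{0..<N}. norm (dirichlet_sum (K * N) s (x + K * k)))
      \<le> 2 * of_int s + of_int N * harm (nat N)"
proof -
  define M where "M = K * N"
  define r where "r = x mod K"
  have r: "0 \<le> r" "r < K" using assms by (simp_all add: r_def)
  have "M > 0" using assms by (simp add: M_def)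
  let ?D = "\<lambda>y. norm (dirichlet_sum M s y)"
  \<comment> \<open>The quotient of \<open>x\<close> by \<open>K\<close> only shifts
    \<open>k\<close>, which a sum over all residues modulo \<open>N\<close> does not see.\<close>
  have "(\<Sum>k\<in>{0..<N}. ?D (x + K * k)) = (\<Sum>k\<in>{0..<N}. ?D (r + K * (k + x div K)))"
  proof -
    have "x + K * k = r + K * (k + x div K)" for k
      using mult_div_mod_eq[of K x] unfolding r_def distrib_left by linarith
    then show ?thesis by simp
  qed
  also have "\<dots> = (\<Sum>k\<in>{0..<N}. ?D (r + K * k))"
  proof (rule sum_residues_shift[OF assms(1)])
    fix k l :: int assume "N dvd k - l"
    then have "M dvd (r + K * k) - (r + K * l)"
      by (simp add: M_def flip: right_diff_distrib)
    then show "?D (r + K * k) = ?D (r + K * l)"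
      using dirichlet_sum_cong[OF \<open>M > 0\<close>] by metis
  qed
  also have "\<dots> \<le> 2 * of_int s + (\<Sum>k\<in>{1..<N-1}. ?D (r + K * k))"
  proof (cases "N = 1")
    case True
    have "(\<Sum>k\<in>{0..<1::int}. ?D (r + K * k)) = ?D r"
    proof -
      have "{0..<1::int} = {0}" by auto
      then show ?thesis by simp
    qed
    with True norm_dirichlet_sum_le[OF assms(3), of M r] assms show ?thesis by simp
  next
    case False
    \<comment> \<open>Only \<open>k = 0\<close> and \<open>k = N - 1\<close> can give a point within
      \<open>1 / N\<close> of an integer.\<close>
    with assms have "{0..<N} = insert 0 (insert (N-1) {1..<N-1})" by auto
    then have "(\<Sum>k\<in>{0..<N}. ?D (r + K * k)) = ?D r + ?D (r + K * (N-1)) + (\<Sum>k\<in>{1..<N-1}. ?D (r + K * k))"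
      using False by simp
    then show ?thesis
      using norm_dirichlet_sum_le[OF assms(3), of M r] norm_dirichlet_sum_le[OF assms(3), of M "r + K * (N-1)"]
      by simp
  qed
  also have "(\<Sum>k\<in>{1..<N-1}. ?D (r + K * k)) \<le>
      (\<Sum>k\<in>{1..<N-1}. of_int N / 2 * (inverse (of_int k) + inverse (of_int (N - 1 - k))))"
  proof (rule sum_mono)
    fix k assume k: "k \<in> {1..<N-1}"
    \<comment> \<open>The position on the circle; since \<open>0 \<le> r < K\<close>, it lies
      between \<open>k / N\<close> and \<open>(k + 1) / N\<close>.\<close>
    define u :: real where "u = of_int (r + K * k) / of_int M"
    have "real_of_int (K * k) \<le> of_int (r + K * k)" using r unfolding of_int_le_iff by simp
    then have u1: "of_int k / of_int N \<le> u"
      using assms \<open>M > 0\<close> by (simp add: u_def M_def field_simps)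
    have "r + K * k \<le> K * (k + 1)" using r by (simp add: algebra_simps)
    then have "real_of_int (r + K * k) \<le> of_int (K * (k + 1))" unfolding of_int_le_iff .
    then have u2: "u \<le> (of_int k + 1) / of_int N"
      using assms \<open>M > 0\<close> by (simp add: u_def M_def field_simps)
    have kN: "0 < real_of_int k / of_int N" "0 < real_of_int (N - 1 - k) / of_int N"
      using k assms by auto
    have u3: "real_of_int (N - 1 - k) / of_int N \<le> 1 - u"
      using u2 assms by (simp add: field_simps)
    have u: "0 < u" "u < 1" using u1 u3 kN by linarith+
    have "2 * u * (1 - u) \<le> sin (pi * u)" using u by (intro sin_pi_ge) auto
    then have "?D (r + K * k) * (2 * u * (1 - u)) \<le> ?D (r + K * k) * \<bar>sin (pi * u)\<bar>"
      by (intro mult_left_mono) auto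
    also have "\<dots> \<le> 1"
      using norm_dirichlet_sum_mult_le[OF assms(3), of M "r + K * k"] by (simp add: u_def)
    finally have "?D (r + K * k) \<le> 1 / (2 * u * (1 - u))"
      using u by (simp add: field_simps)
    also have "\<dots> = (inverse u + inverse (1 - u)) / 2"
      using u by (simp add: field_simps)
    also have "\<dots> \<le> (inverse (of_int k / of_int N) + inverse (of_int (N - 1 - k) / of_int N)) / 2"
      using u1 u3 kN by (intro divide_right_mono add_mono le_imp_inverse_le) auto
    also have "\<dots> = of_int N / 2 * (inverse (of_int k) + inverse (of_int (N - 1 - k)))"
      by (simp add: field_simps)
    finally show "?D (r + K * k) \<le> \<dots>" .
  qed
  also have "\<dots> = of_int N / 2 * ((\<Sum>k\<in>{1..<N-1}. inverse (of_int k)) + (\<Sum>k\<in>{1..<N-1}. inverse (of_int (N - 1 - k))))"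
    by (simp only: sum.distrib flip: sum_distrib_left)
  also have "(\<Sum>k\<in>{1..<N-1}. inverse (real_of_int (N - 1 - k))) = (\<Sum>k\<in>{1..<N-1}. inverse (of_int k))"
    by (rule sum.reindex_bij_witness[where i = "\<lambda>k. N - 1 - k" and j = "\<lambda>k. N - 1 - k"]) auto
  also have "(\<Sum>k\<in>{1..<N-1}. inverse (real_of_int k)) \<le> (\<Sum>k\<in>{1..N}. inverse (real_of_int k))"
    by (rule sum_mono2) auto
  also have "(\<Sum>k\<in>{1..N}. inverse (real_of_int k)) = harm (nat N)"
    unfolding harm_def
    by (rule sum.reindex_bij_witness[where i = int and j = nat]) auto
  finally show ?thesis using assms(1) by (simp add: M_def)
qed

section \<open>Sums over additive quadruples\<close>

text \<open>Nested one-variable transforms, so that \<open>fourier_inversion\<close> can be applied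
  once per variable.\<close>

definition fourier3 :: "int \<Rightarrow> (int \<Rightarrow> int \<Rightarrow> int \<Rightarrow> complex) \<Rightarrow> int \<Rightarrow> int \<Rightarrow> int \<Rightarrow> complex" where
  "fourier3 N E k1 k2 k3 = (\<Sum>z\<in>{0..<N}. (\<Sum>y\<in>{0..<N}. (\<Sum>x\<in>{0..<N}. E x y z
     * root_char N (- (k1 * x))) * root_char N (- (k2 * y))) * root_char N (- (k3 * z)))"

lemma fourier3_inversion:
  assumes "N > 0"
    and per: "\<And>x x' y y' z z'. N dvd x - x' \<Longrightarrow> N dvd y - y' \<Longrightarrow> N dvd z - z' \<Longrightarrow> E x y z = E x' y' z'"
  shows "of_int N ^ 3 * E x y z = (\<Sum>(k3, k2, k1)\<in>{0..<N} \<times> {0..<N} \<times> {0..<N}.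
    fourier3 N E k1 k2 k3 * (root_char N (k1 * x) * root_char N (k2 * y) * root_char N (k3 * z)))"
proof -
  define F1 where "F1 k1 y z = (\<Sum>x\<in>{0..<N}. E x y z * root_char N (- (k1 * x)))" for k1 y z
  define F2 where "F2 k1 k2 z = (\<Sum>y\<in>{0..<N}. F1 k1 y z * root_char N (- (k2 * y)))" for k1 k2 z
  have F1: "F1 k1 y z = F1 k1 y' z'" if "N dvd y - y'" "N dvd z - z'" for k1 y y' z z'
    unfolding F1_def using that by (intro sum.cong refl arg_cong2[where f = "(*)"] per) simp_all
  have F2: "F2 k1 k2 z = F2 k1 k2 z'" if "N dvd z - z'" for k1 k2 z z'
    unfolding F2_def using that by (intro sum.cong refl arg_cong2[where f = "(*)"] F1) simp_all
  have 1: "of_int N * E x y z = (\<Sum>k1\<in>{0..<N}. F1 k1 y z * root_char N (k1 * x))" for y z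
    unfolding F1_def
    by (rule fourier_inversion[OF assms(1), where f = "\<lambda>x. E x y z"]) (simp add: per)
  have 2: "of_int N * F1 k1 y z = (\<Sum>k2\<in>{0..<N}. F2 k1 k2 z * root_char N (k2 * y))" for k1 z
    unfolding F2_def
    by (rule fourier_inversion[OF assms(1), where f = "\<lambda>y. F1 k1 y z"]) (simp add: F1)
  have 3: "of_int N * F2 k1 k2 z = (\<Sum>k3\<in>{0..<N}. fourier3 N E k1 k2 k3 * root_char N (k3 * z))" for k1 k2
    unfolding fourier3_def F1_def[symmetric] F2_def[symmetric]
    by (rule fourier_inversion[OF assms(1), where f = "\<lambda>z. F2 k1 k2 z"]) (simp add: F2)
  have "of_int N ^ 3 * E x y z = of_int N * (of_int N * (of_int N * E x y z))"
    by (simp add: power3_eq_cube mult.assoc)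
  also have "\<dots> = of_int N * (\<Sum>k1\<in>{0..<N}. of_int N * F1 k1 y z * root_char N (k1 * x))"
    unfolding 1 sum_distrib_left by (simp add: mult.assoc)
  also have "\<dots> = (\<Sum>k1\<in>{0..<N}. \<Sum>k2\<in>{0..<N}. of_int N * F2 k1 k2 z * root_char N (k2 * y) * root_char N (k1 * x))"
    unfolding 2 sum_distrib_left sum_distrib_right by (simp add: mult.assoc)
  also have "\<dots> = (\<Sum>k1\<in>{0..<N}. \<Sum>k2\<in>{0..<N}. \<Sum>k3\<in>{0..<N}.
      fourier3 N E k1 k2 k3 * root_char N (k3 * z) * root_char N (k2 * y) * root_char N (k1 * x))"
    unfolding 3 sum_distrib_right by simp
  also have "\<dots> = (\<Sum>(k1, k2, k3)\<in>{0..<N} \<times> {0..<N} \<times> {0..<N}.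
      fourier3 N E k1 k2 k3 * root_char N (k3 * z) * root_char N (k2 * y) * root_char N (k1 * x))"
    by (simp only: sum.cartesian_product)
  \<comment> \<open>The order with \<open>k3\<close> outside \<open>k2\<close> and \<open>k1\<close>
    is the one in which the frequencies are later summed.\<close>
  also have "\<dots> = (\<Sum>(k3, k2, k1)\<in>{0..<N} \<times> {0..<N} \<times> {0..<N}.
    fourier3 N E k1 k2 k3 * (root_char N (k1 * x) * root_char N (k2 * y) * root_char N (k3 * z)))"
    by (rule sum.reindex_bij_witness[where i = "\<lambda>(k3, k2, k1). (k1, k2, k3)" and j = "\<lambda>(k1, k2, k3). (k3, k2, k1)"])
       (auto simp: mult_ac)
  finally show ?thesis .
qed

lemma sum_times4:
  fixes f g h k :: "'a \<Rightarrow> 'b::comm_semiring_0"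
  shows "(\<Sum>(a, b, c, d)\<in>A \<times> B \<times> C \<times> D. f a * g b * h c * k d)
    = sum f A * sum g B * sum h C * sum k D"
  by (simp only: sum.cartesian_product[symmetric] mult.assoc
      sum_distrib_left[symmetric] sum_distrib_right[symmetric])

definition additive_quads :: "int \<Rightarrow> (int \<times> int \<times> int \<times> int) set" where
  "additive_quads s =
     {(a, b, c, d) \<in> {0..<s} \<times> {0..<s} \<times> {0..<s} \<times> {0..<s}. a + b = c + d}"

lemma finite_additive_quads [simp]: "finite (additive_quads s)"
  unfolding additive_quads_def by (rule finite_subset[of _ "{0..<s} \<times> {0..<s} \<times> {0..<s} \<times> {0..<s}"]) auto

text \<open>After Fourier expansion the variables \<open>a\<close>, \<open>b\<close>,
  \<open>c\<close>, \<open>d\<close> separate into four Dirichlet kernels, so that \<open>Q\<close>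
  times an \<open>L^1\<close> norm of their product remains. Each kernel contributes one factor
  \<open>2 * s / N + harm (nat N)\<close>.\<close>

lemma sum_additive_quads_le:
  assumes "N > 0" "s \<ge> 0"
    and per: "\<And>x x' y y' z z'. N dvd x - x' \<Longrightarrow> N dvd y - y' \<Longrightarrow> N dvd z - z' \<Longrightarrow> E x y z = E x' y' z'"
    and Q: "\<And>k1 k2 k3. norm (fourier3 N E k1 k2 k3) \<le> Q"
  shows "norm (\<Sum>(a, b, c, d)\<in>additive_quads s. E a d (c - a))
     \<le> Q * (2 * of_int s / of_int N + harm (nat N)) ^ 4"
proof -
  txt \<open>A modulus \<open>M > 2 * s\<close> detects \<open>a + b = c + d\<close> by congruence; taking it to be a multiple of \<open>N\<close>
    merges both kinds of characters into characters modulo \<open>M\<close>.\<close>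
  define K where "K = 2 * s + 1"
  define M where "M = K * N"
  define B :: real where "B = 2 * of_int s + of_int N * harm (nat N)"
  have "K > 0" "M > 0" using assms by (simp_all add: K_def M_def)
  have "K * 1 \<le> M" unfolding M_def using assms \<open>K > 0\<close> by (intro mult_left_mono) auto
  then have M: "2 * s < M" by (simp add: K_def)
  define D where "D = dirichlet_sum M s"
  have Dcong: "D x = D y" if "M dvd x - y" for x y
    unfolding D_def by (rule dirichlet_sum_cong[OF \<open>M > 0\<close> that])
  have B: "(\<Sum>k\<in>{0..<N}. norm (D (x + K * k))) \<le> B" for x
    unfolding D_def B_def M_def using assms(1,2) \<open>K > 0\<close> by (intro sum_norm_dirichlet_sum_le)
  have "B \<ge> 0" using B[of 0] by (meson norm_ge_zero order_trans sum_nonneg)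
  have B': "(\<Sum>k\<in>{0..<N}. norm (D (K * k - x))) \<le> B" for x
    using B[of "-x"] by simp
  have B'': "(\<Sum>k\<in>{0..<N}. norm (D (x + K * (k - y)))) \<le> B" for x y
    using B[of "x - K * y"] by (simp add: algebra_simps)
  let ?S = "{0..<s}" let ?N = "{0..<N}"
  let ?box = "?S \<times> ?S \<times> ?S \<times> ?S"
  let ?I = "{0..<M} \<times> ?N \<times> ?N \<times> ?N"
  let ?F = "fourier3 N E"
  let ?e = "root_char M"
  have D4: "D x * D y * D z * D w = (\<Sum>(a, b, c, d)\<in>?box. ?e (x * a) * ?e (y * b) * ?e (z * c) * ?e (w * d))"
    for x y z w
    unfolding D_def dirichlet_sum_def by (rule sum_times4[symmetric])
  have "of_int M * of_int N ^ 3 * (\<Sum>(a, b, c, d)\<in>additive_quads s. E a d (c - a))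
      = (\<Sum>(a, b, c, d)\<in>?box. of_int N ^ 3 * E a d (c - a) * (if a + b = c + d then of_int M else 0))"
  proof -
    have "additive_quads s = {p \<in> ?box. case p of (a, b, c, d) \<Rightarrow> a + b = c + d}"
      by (auto simp: additive_quads_def)
    then show ?thesis
      by (simp only: sum_distrib_left) (subst sum.inter_filter, auto intro!: sum.cong)
  qed
  also have "\<dots> = (\<Sum>(a, b, c, d)\<in>?box. \<Sum>(j, k3, k2, k1)\<in>?I. ?F k1 k2 k3 *
      (?e ((j + K * (k1 - k3)) * a) * ?e (j * b) * ?e ((K * k3 - j) * c) * ?e ((K * k2 - j) * d)))"
  proof (intro sum.cong refl, clarify)
    fix a b c d assume abcd: "a \<in> ?S" "b \<in> ?S" "c \<in> ?S" "d \<in> ?S"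
    have *: "a + b - c - d = 0" if "M dvd a + b - c - d"
    proof (rule ccontr)
      assume "a + b - c - d \<noteq> 0"
      then have "\<bar>M\<bar> \<le> \<bar>a + b - c - d\<bar>" using that by (intro dvd_imp_le_int) auto
      then show False using M abcd by auto
    qed
    have "a + b = c + d \<longleftrightarrow> M dvd a + b - c - d"
    proof
      assume "M dvd a + b - c - d"
      from *[OF this] show "a + b = c + d" by linarith
    qed simp
    then have ind: "(if a + b = c + d then of_int M else 0) = (\<Sum>j\<in>{0..<M}. ?e ((a + b - c - d) * j))"
      by (simp only: sum_root_char[OF \<open>M > 0\<close>])
    have N_M: "root_char N x = ?e (K * x)" for x
      unfolding M_def by (rule root_char_mult_cancel[symmetric, OF \<open>K > 0\<close>])
    have inv: "of_int N ^ 3 * E a d (c - a) = (\<Sum>(k3, k2, k1)\<in>?N \<times> ?N \<times> ?N. ?F k1 k2 k3 *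
       (?e (K * (k1 * a)) * ?e (K * (k2 * d)) * ?e (K * (k3 * (c - a)))))"
      unfolding N_M[symmetric] by (rule fourier3_inversion[OF assms(1) per])
    \<comment> \<open>The exponents are regrouped so that each of \<open>a\<close>,
      \<open>b\<close>, \<open>c\<close>, \<open>d\<close> carries its own frequency.\<close>
    have e: "?e ((a + b - c - d) * j) * (?e (K * (k1 * a)) * ?e (K * (k2 * d)) * ?e (K * (k3 * (c - a)))) =
      ?e ((j + K * (k1 - k3)) * a) * ?e (j * b) * ?e ((K * k3 - j) * c) * ?e ((K * k2 - j) * d)" for j k1 k2 k3
      unfolding root_char_add[symmetric] by (rule arg_cong[where f = ?e]) (simp add: algebra_simps)
    have "of_int N ^ 3 * E a d (c - a) * (if a + b = c + d then of_int M else 0) =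
      (\<Sum>j\<in>{0..<M}. ?e ((a + b - c - d) * j)) * (of_int N ^ 3 * E a d (c - a))"
      unfolding ind by (rule mult.commute)
    also have "\<dots> = (\<Sum>(j, k3, k2, k1)\<in>?I. ?F k1 k2 k3 * (?e ((a + b - c - d) * j) *
        (?e (K * (k1 * a)) * ?e (K * (k2 * d)) * ?e (K * (k3 * (c - a))))))"
      unfolding inv sum_product sum.cartesian_product by (intro sum.cong refl) (clarsimp simp: mult_ac)
    finally show "of_int N ^ 3 * E a d (c - a) * (if a + b = c + d then of_int M else 0) =
      (\<Sum>(j, k3, k2, k1)\<in>?I. ?F k1 k2 k3 *
      (?e ((j + K * (k1 - k3)) * a) * ?e (j * b) * ?e ((K * k3 - j) * c) * ?e ((K * k2 - j) * d)))"
      unfolding e .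
  qed
  also have "\<dots> = (\<Sum>(j, k3, k2, k1)\<in>?I. \<Sum>(a, b, c, d)\<in>?box. ?F k1 k2 k3 *
      (?e ((j + K * (k1 - k3)) * a) * ?e (j * b) * ?e ((K * k3 - j) * c) * ?e ((K * k2 - j) * d)))"
    unfolding split_def by (rule sum.swap)
  also have "\<dots> = (\<Sum>(j, k3, k2, k1)\<in>?I. ?F k1 k2 k3 *
      (D (j + K * (k1 - k3)) * D j * D (K * k3 - j) * D (K * k2 - j)))"
    unfolding D4 sum_distrib_left
    by (intro sum.cong refl) (auto simp: split_def)
  finally have eq: "of_int M * of_int N ^ 3 * (\<Sum>(a, b, c, d)\<in>additive_quads s. E a d (c - a)) = \<dots>" .
  have Q0: "Q \<ge> 0" using Q[of 0 0 0] norm_ge_zero order_trans by blast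
  \<comment> \<open>A sum over all residues modulo \<open>M\<close> is unchanged by the shifts
    \<open>K * k\<close>; averaging over them reduces it to the sums bounded by
    \<open>B\<close>.\<close>
  have sumD: "of_int N * (\<Sum>j\<in>{0..<M}. norm (D j)) \<le> of_int M * B"
  proof -
    have "of_int N * (\<Sum>j\<in>{0..<M}. norm (D j)) = (\<Sum>k\<in>?N. \<Sum>j\<in>{0..<M}. norm (D (j + K * k)))"
      using assms(1) by (subst sum_residues_shift[OF \<open>M > 0\<close>]) (auto intro: arg_cong[where f = norm] Dcong)
    also have "\<dots> = (\<Sum>j\<in>{0..<M}. \<Sum>k\<in>?N. norm (D (j + K * k)))" by (rule sum.swap)
    also have "\<dots> \<le> (\<Sum>j\<in>{0..<M}. B)" by (intro sum_mono B)
    finally show ?thesis using \<open>M > 0\<close> by simp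
  qed
  have "of_int M * of_int N ^ 3 * norm (\<Sum>(a, b, c, d)\<in>additive_quads s. E a d (c - a))
    = norm (of_int M * of_int N ^ 3 * (\<Sum>(a, b, c, d)\<in>additive_quads s. E a d (c - a)))"
    using assms(1) \<open>M > 0\<close> by (simp add: norm_mult norm_power)
  also have "\<dots> \<le> (\<Sum>(j, k3, k2, k1)\<in>?I. Q *
      (norm (D (j + K * (k1 - k3))) * norm (D j) * norm (D (K * k3 - j)) * norm (D (K * k2 - j))))"
    unfolding eq by (intro sum_norm_le) (auto simp: norm_mult intro!: mult_right_mono Q)
  also have "\<dots> = Q * (\<Sum>j\<in>{0..<M}. norm (D j) * (\<Sum>k3\<in>?N. norm (D (K * k3 - j)) *
       ((\<Sum>k2\<in>?N. norm (D (K * k2 - j))) * (\<Sum>k1\<in>?N. norm (D (j + K * (k1 - k3)))))))"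
    unfolding sum_product unfolding sum_distrib_left sum.cartesian_product
    by (intro sum.cong refl) (auto simp: mult_ac)
  \<comment> \<open>The bound \<open>B\<close> is uniform in the shift, so the sums over
    \<open>k1\<close> and \<open>k2\<close> are removed first, whatever \<open>j\<close> and
    \<open>k3\<close> are; those over \<open>k3\<close> and \<open>j\<close> follow.\<close>
  also have "\<dots> \<le> Q * (\<Sum>j\<in>{0..<M}. norm (D j) * (\<Sum>k3\<in>?N. norm (D (K * k3 - j)) * (B * B)))"
    using Q0 \<open>B \<ge> 0\<close> by (intro mult_left_mono sum_mono mult_mono B' B'' sum_nonneg) auto
  also have "\<dots> \<le> Q * (\<Sum>j\<in>{0..<M}. norm (D j) * (B * (B * B)))"
  proof -
    have "(\<Sum>k3\<in>?N. norm (D (K * k3 - j)) * (B * B)) \<le> B * (B * B)" for j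
      unfolding sum_distrib_right[symmetric] using \<open>B \<ge> 0\<close> by (intro mult_right_mono B') auto
    then show ?thesis using Q0 by (intro mult_left_mono sum_mono) auto
  qed
  also have "\<dots> = Q * B ^ 3 * (\<Sum>j\<in>{0..<M}. norm (D j))"
    by (simp add: sum_distrib_left sum_distrib_right power3_eq_cube mult_ac)
  finally have "of_int N * (of_int M * of_int N ^ 3 * norm (\<Sum>(a, b, c, d)\<in>additive_quads s. E a d (c - a)))
     \<le> of_int N * (Q * B ^ 3 * (\<Sum>j\<in>{0..<M}. norm (D j)))"
    using assms(1) by (intro mult_left_mono) auto
  also have "\<dots> = Q * B ^ 3 * (of_int N * (\<Sum>j\<in>{0..<M}. norm (D j)))" by simp
  also have "\<dots> \<le> Q * B ^ 3 * (of_int M * B)"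
    using Q0 \<open>B \<ge> 0\<close> by (intro mult_left_mono sumD) auto
  finally have "of_int M * (of_int N ^ 4 * norm (\<Sum>(a, b, c, d)\<in>additive_quads s. E a d (c - a))) \<le> of_int M * (Q * B ^ 4)"
    by (simp add: power4_eq_xxxx power3_eq_cube mult_ac)
  then have "of_int N ^ 4 * norm (\<Sum>(a, b, c, d)\<in>additive_quads s. E a d (c - a)) \<le> Q * B ^ 4"
    using \<open>M > 0\<close> by simp
  then have "norm (\<Sum>(a, b, c, d)\<in>additive_quads s. E a d (c - a)) \<le> Q * (B / of_int N) ^ 4"
    using assms(1) by (simp add: field_simps)
  also have "B / of_int N = 2 * of_int s / of_int N + harm (nat N)"
    using assms(1) by (simp add: B_def field_simps)
  finally show ?thesis .
qed

section \<open>Counting additive quadruples\<close>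

text \<open>For fixed \<open>m = c - a\<close> also \<open>b = d + m\<close>, so \<open>a\<close>
  and \<open>d\<close> range independently over the same interval of
  \<open>s - \<bar>m\<bar>\<close> integers.\<close>

lemma card_additive_quads_diff:
  assumes "s \<ge> 0"
  shows "real (card {(a, b, c, d) \<in> additive_quads s. P (c - a)})
    = (\<Sum>m | m \<in> {-s<..<s} \<and> P m. (of_int (s - \<bar>m\<bar>))\<^sup>2)"
proof -
  let ?I = "\<lambda>m. {a \<in> {0..<s}. a + m \<in> {0..<s}}"
  let ?M = "{m \<in> {-s<..<s}. P m}"
  have "bij_betw (\<lambda>(m, a, d). (a, d + m, a + m, d)) (SIGMA m:?M. ?I m \<times> ?I m)
     {(a, b, c, d) \<in> additive_quads s. P (c - a)}"
    by (rule bij_betw_byWitness[where f' = "\<lambda>(a, b, c, d). (c - a, a, d)"])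
       (auto simp: additive_quads_def)
  then have "card {(a, b, c, d) \<in> additive_quads s. P (c - a)} = card (SIGMA m:?M. ?I m \<times> ?I m)"
    by (rule bij_betw_same_card[symmetric])
  also have "\<dots> = (\<Sum>m\<in>?M. card (?I m \<times> ?I m))"
  proof (rule card_SigmaI)
    show "finite ?M" by (rule finite_subset[of _ "{-s<..<s}"]) auto
    have I: "finite (?I m)" for m by (rule finite_subset[of _ "{0..<s}"]) auto
    show "\<forall>m\<in>?M. finite (?I m \<times> ?I m)" by (intro ballI finite_cartesian_product I)
  qed
  finally have card: "card {(a, b, c, d) \<in> additive_quads s. P (c - a)} = (\<Sum>m\<in>?M. card (?I m \<times> ?I m))" .
  show ?thesis
    unfolding card of_nat_sum
  proof (intro sum.cong refl)
    fix m assume "m \<in> ?M"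
    then have b: "- s < m" "m < s" by simp_all
    have m: "min s (s - m) - max 0 (- m) = s - \<bar>m\<bar>" "s - \<bar>m\<bar> \<ge> 0"
      using b by linarith+
    have "?I m = {max 0 (- m)..<min s (s - m)}"
      by auto
    then have "card (?I m) = nat (s - \<bar>m\<bar>)" by (simp only: card_atLeastLessThan_int m)
    then have "real (card (?I m)) = of_int (s - \<bar>m\<bar>)" using m(2) by simp
    then show "real (card (?I m \<times> ?I m)) = (of_int (s - \<bar>m\<bar>))\<^sup>2"
      by (simp only: card_cartesian_product power2_eq_square of_nat_mult)
  qed
qed

text \<open>Exchanging \<open>c\<close> and \<open>d\<close> preserves the equation and carries one
  divisibility condition to the other up to sign.\<close>

lemma card_additive_quads_swap:
  "card {(a, b, c, d) \<in> additive_quads s. N dvd a - d} = card {(a, b, c, d) \<in> additive_quads s. N dvd c - a}"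
  by (rule bij_betw_same_card[where f = "\<lambda>(a, b, c, d). (a, b, d, c)"],
      rule bij_betw_byWitness[where f' = "\<lambda>(a, b, c, d). (a, b, d, c)"])
     (auto simp: additive_quads_def dvd_diff_commute)

text \<open>The differences \<open>m \<ge> 0\<close> and \<open>m < 0\<close> each contribute a sum
  of consecutive squares. The leading term \<open>2 / 3 * s ^ 3\<close> is the source of the linear
  term of the limit.\<close>

lemma card_additive_quads:
  "real (card (additive_quads (int s))) = real s * (2 * (real s)\<^sup>2 + 1) / 3"
proof -
  have split: "{-int s<..<int s} = {0..<int s} \<union> {-int s<..<0}" by auto
  have "(\<Sum>m\<in>{-int s<..<int s}. (real_of_int (int s - \<bar>m\<bar>))\<^sup>2)
     = (\<Sum>m\<in>{0..<int s}. (real_of_int (int s - m))\<^sup>2) + (\<Sum>m\<in>{-int s<..<0}. (real_of_int (int s + m))\<^sup>2)"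
    unfolding split
    by (subst sum.union_disjoint) (auto intro!: arg_cong2[where f = "(+)"] sum.cong)
  also have "(\<Sum>m\<in>{0..<int s}. (real_of_int (int s - m))\<^sup>2) = (\<Sum>i\<in>{0..<s}. (real (Suc i))\<^sup>2)"
    by (rule sum.reindex_bij_witness[where j = "\<lambda>m. nat (int s - 1 - m)" and i = "\<lambda>i. int s - 1 - int i"])
       (auto simp: of_nat_diff)
  also have "(\<Sum>m\<in>{-int s<..<0}. (real_of_int (int s + m))\<^sup>2) = (\<Sum>i\<in>{1..<s}. (real i)\<^sup>2)"
    by (rule sum.reindex_bij_witness[where j = "\<lambda>m. nat (int s + m)" and i = "\<lambda>i. int i - int s"])
       auto
  also have "(\<Sum>i\<in>{1..<s}. (real i)\<^sup>2) = (\<Sum>i\<in>{0..<s}. (real i)\<^sup>2)"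
    by (rule sum.mono_neutral_left) (auto simp: not_le)
  also have "(\<Sum>i\<in>{0..<s}. (real (Suc i))\<^sup>2) + (\<Sum>i\<in>{0..<s}. (real i)\<^sup>2) = real s * (2 * (real s)\<^sup>2 + 1) / 3"
    by (induction s) (simp_all add: field_simps power2_eq_square)
  finally have "(\<Sum>m\<in>{-int s<..<int s}. (real_of_int (int s - \<bar>m\<bar>))\<^sup>2) = real s * (2 * (real s)\<^sup>2 + 1) / 3" .
  moreover have "{(a, b, c, d) \<in> additive_quads (int s). True} = additive_quads (int s)"
    and "{m. m \<in> {-int s<..<int s} \<and> True} = {-int s<..<int s}" by auto
  ultimately show ?thesis
    using card_additive_quads_diff[of "int s" "\<lambda>_. True"] by (simp only: of_nat_0_le_iff)
qed

text \<open>Only differences \<open>m = N * n\<close> count, and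
  \<open>(s - N * \<bar>n\<bar>)^2\<close> is \<open>s^2\<close> times the summand of
  \<open>Omega\<close> at \<open>N / s\<close>.\<close>

lemma card_additive_quads_dvd:
  assumes "N > 0" "s > 0"
  shows "real (card {(a, b, c, d) \<in> additive_quads s. N dvd c - a})
    = (of_int s)\<^sup>2 * Omega (of_int N / of_int s) 0"
proof -
  let ?f = "\<lambda>n. (max 0 (of_int s - of_int N * real_of_int \<bar>n\<bar>))\<^sup>2"
  \<comment> \<open>Because \<open>N \<ge> 1\<close>, the range from \<open>-s\<close> to
    \<open>s\<close> already contains every nonzero term.\<close>
  have "s + 1 \<le> N * (s + 1)" using assms by simp
  then have "real_of_int (s + 1) \<le> of_int (N * (s + 1))" unfolding of_int_le_iff .
  then have "1 \<le> of_int N / of_int s * (real_of_int s + 1)" using assms by (simp add: field_simps)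
  then have "(of_int s)\<^sup>2 * Omega (of_int N / of_int s) 0
     = (\<Sum>n\<in>{-s..s}. (of_int s)\<^sup>2 * (max 0 (1 - of_int N / of_int s * of_int \<bar>n\<bar>))\<^sup>2)"
    using assms by (subst Omega_eq_finite_sum[of _ s]) (auto simp: sum_distrib_left)
  also have "\<dots> = (\<Sum>n\<in>{-s..s}. ?f n)"
  proof (intro sum.cong refl)
    fix n :: int
    have "of_int s * (1 - of_int N / of_int s * real_of_int \<bar>n\<bar>) = of_int s - of_int N * real_of_int \<bar>n\<bar>"
      using assms by (simp add: field_simps)
    then have "of_int s * max 0 (1 - of_int N / of_int s * real_of_int \<bar>n\<bar>) = max 0 (of_int s - of_int N * real_of_int \<bar>n\<bar>)"
      using assms by (simp only: max_mult_distrib_left) simp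
    then show "(of_int s)\<^sup>2 * (max 0 (1 - of_int N / of_int s * real_of_int \<bar>n\<bar>))\<^sup>2 = ?f n"
      by (metis power_mult_distrib)
  qed
  also have "\<dots> = (\<Sum>n\<in>{n\<in>{-s..s}. N * \<bar>n\<bar> < s}. ?f n)"
  proof (rule sum.mono_neutral_right)
    show "\<forall>n\<in>{-s..s} - {n \<in> {-s..s}. N * \<bar>n\<bar> < s}. ?f n = 0"
    proof
      fix n assume "n \<in> {-s..s} - {n \<in> {-s..s}. N * \<bar>n\<bar> < s}"
      then have "s \<le> N * \<bar>n\<bar>" by auto
      then have "real_of_int s \<le> of_int (N * \<bar>n\<bar>)" unfolding of_int_le_iff .
      then show "?f n = 0" by simp
    qed
  qed auto
  also have "\<dots> = (\<Sum>m | m \<in> {-s<..<s} \<and> N dvd m. (of_int (s - \<bar>m\<bar>))\<^sup>2)"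
  proof (rule sum.reindex_bij_witness[where i = "\<lambda>m. m div N" and j = "\<lambda>n. N * n"])
    fix n assume n: "n \<in> {n\<in>{-s..s}. N * \<bar>n\<bar> < s}"
    then have "\<bar>N * n\<bar> < s" using assms by (simp add: abs_mult)
    then show "N * n \<in> {m. m \<in> {-s<..<s} \<and> N dvd m}" by auto
    have "real_of_int (N * \<bar>n\<bar>) < of_int s" using n unfolding of_int_less_iff by simp
    then show "(of_int (s - \<bar>N * n\<bar>))\<^sup>2 = ?f n" using assms by (simp add: abs_mult)
  next
    fix m assume m: "m \<in> {m. m \<in> {-s<..<s} \<and> N dvd m}"
    then obtain n where n: "m = N * n" by auto
    have "\<bar>N * n\<bar> < s" using m n by auto
    then have "N * \<bar>n\<bar> < s" using assms by (simp add: abs_mult)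
    moreover have "1 * \<bar>n\<bar> \<le> N * \<bar>n\<bar>" using assms by (intro mult_right_mono) auto
    ultimately show "m div N \<in> {n\<in>{-s..s}. N * \<bar>n\<bar> < s}" using assms by (auto simp: n)
  qed (use assms in auto)
  also have "\<dots> = real (card {(a, b, c, d) \<in> additive_quads s. N dvd c - a})"
    by (rule card_additive_quads_diff[OF less_imp_le[OF assms(2)], of "\<lambda>m. N dvd m", symmetric])
  finally show ?thesis by simp
qed

section \<open>Gauss sums of a finite field\<close>

text \<open>\<open>N\<close> is the order of the multiplicative group, taken as an integer because
  it is the period of \<open>\<alpha>\<close>.\<close>

locale finite_field_arrangement = field R for R (structure) +
  fixes \<alpha> :: "int \<Rightarrow> 'a" and \<psi> :: "'a \<Rightarrow> complex" and N :: int
  assumes finite_carrier: "finite (carrier R)"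
    and arrangement: "\<alpha> \<in> epi integer_group (units_of R)"
    and character: "nontrivial_additive_character R \<psi>"
    and N_def: "N = int (card (carrier R)) - 1"
begin

lemma alpha_Units: "\<alpha> x \<in> Units R"
  using arrangement by (auto simp: epi_def units_of_carrier)

lemma alpha_closed [simp, intro]: "\<alpha> x \<in> carrier R"
  and alpha_nonzero [simp]: "\<alpha> x \<noteq> \<zero>"
  using alpha_Units[of x] by (auto simp: field_Units)

lemma alpha_add: "\<alpha> (x + y) = \<alpha> x \<otimes> \<alpha> y"
  using arrangement by (auto simp: epi_def hom_def units_of_mult)

lemma alpha_surj: "y \<in> carrier R \<Longrightarrow> y \<noteq> \<zero> \<Longrightarrow> \<exists>x. y = \<alpha> x"
proof -
  assume "y \<in> carrier R" "y \<noteq> \<zero>"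
  then have "y \<in> range \<alpha>"
    using arrangement by (simp add: epi_def units_of_carrier field_Units)
  then show ?thesis by blast
qed

lemma alpha_0 [simp]: "\<alpha> 0 = \<one>"
proof -
  have "\<alpha> 0 \<otimes> \<alpha> 0 = \<alpha> 0 \<otimes> \<one>" using alpha_add[of 0 0] by simp
  then show ?thesis by (subst (asm) m_lcancel) auto
qed

lemma card_Units: "int (card (Units R)) = N"
proof -
  have "card (carrier R) > 0" using finite_carrier by (auto simp: card_gt_0_iff)
  then show ?thesis using finite_carrier by (simp add: field_Units N_def)
qed

lemma N_pos: "N > 0"
proof -
  have "card {\<zero>, \<one>} \<le> card (carrier R)"
    by (rule card_mono[OF finite_carrier]) auto
  then show ?thesis by (simp add: N_def)
qed

lemma alpha_N: "\<alpha> N = \<one>"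
proof -
  have "\<alpha> (int n) = \<alpha> 1 [^] n" for n
    by (induction n) (simp_all add: alpha_add add.commute[of 1] m_comm)
  then have "\<alpha> N = \<alpha> 1 [^] card (Units R)" by (simp flip: card_Units)
  also have "\<dots> = \<one>"
    using finite_carrier alpha_Units by (intro units_power_order_eq_one) (auto simp: field_Units)
  finally show ?thesis .
qed

lemma alpha_multiple: "\<alpha> (k * N) = \<one>"
proof (induction k rule: int_induct[where k = 0])
  case (step1 i)
  then show ?case by (simp add: distrib_right alpha_add alpha_N)
next
  case (step2 i)
  have "\<alpha> (i * N) = \<alpha> ((i - 1) * N) \<otimes> \<alpha> N"
    by (simp add: algebra_simps flip: alpha_add)
  then show ?case using step2 by (simp add: alpha_N)
qed simp

lemma alpha_cong: "N dvd x - y \<Longrightarrow> \<alpha> x = \<alpha> y"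
proof -
  assume "N dvd x - y"
  then obtain k where "x = y + k * N" by (metis dvd_def add_diff_cancel_left' diff_add_cancel mult.commute add.commute)
  then show ?thesis by (simp add: alpha_add alpha_multiple)
qed

text \<open>By periodicity \<open>N\<close> consecutive arguments exhaust the image, which has
  exactly \<open>N\<close> elements; injectivity follows by counting.\<close>

lemma bij_betw_alpha: "bij_betw \<alpha> {0..<N} (carrier R - {\<zero>})"
proof -
  have "\<alpha> x \<in> \<alpha> ` {0..<N}" for x
  proof -
    have "\<alpha> x = \<alpha> (x mod N)" by (rule alpha_cong) simp
    then show ?thesis using N_pos by auto
  qed
  then have im: "\<alpha> ` {0..<N} = carrier R - {\<zero>}" using alpha_surj by auto
  have "card (\<alpha> ` {0..<N}) = card {0..<N}"
    using card_Units by (simp add: im field_Units)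
  then have "inj_on \<alpha> {0..<N}" by (intro eq_card_imp_inj_on) auto
  then show ?thesis using im by (simp add: bij_betw_def)
qed

lemma alpha_eq_one_iff: "x \<in> {0..<N} \<Longrightarrow> \<alpha> x = \<one> \<longleftrightarrow> x = 0"
  using bij_betw_alpha N_pos alpha_0 unfolding bij_betw_def inj_on_def by (metis atLeastLessThan_iff order_refl)

section \<open>The additive character\<close>

lemma psi_add: "x \<in> carrier R \<Longrightarrow> y \<in> carrier R \<Longrightarrow> \<psi> (x \<oplus> y) = \<psi> x * \<psi> y"
  and psi_nonzero: "x \<in> carrier R \<Longrightarrow> \<psi> x \<noteq> 0"
  using character
  by (auto simp: nontrivial_additive_character_def additive_character_def hom_def complex_units_def Pi_iff)

lemma psi_zero [simp]: "\<psi> \<zero> = 1"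
  using psi_add[of \<zero> \<zero>] psi_nonzero[of \<zero>] by simp

lemma norm_psi [simp]:
  assumes "x \<in> carrier R" shows "norm (\<psi> x) = 1"
proof -
  have le: "norm (\<psi> x) \<le> 1" if "x \<in> carrier R" for x
  proof -
    txt \<open>The maximum of \<open>norm (\<psi> z)\<close> is at least its own square, attained at \<open>z \<oplus> z\<close>.\<close>
    let ?A = "(\<lambda>x. norm (\<psi> x)) ` carrier R"
    have "Max ?A \<in> ?A" using finite_carrier that by (intro Max_in) auto
    then obtain z where z: "z \<in> carrier R" "norm (\<psi> z) = Max ?A" by auto
    have "norm (\<psi> (z \<oplus> z)) \<le> norm (\<psi> z)"
      using z finite_carrier by (auto intro!: Max_ge)
    then have "norm (\<psi> z) * norm (\<psi> z) \<le> norm (\<psi> z) * 1"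
      using z(1) by (simp add: psi_add norm_mult)
    then have "norm (\<psi> z) \<le> 1"
      using psi_nonzero[OF z(1)] by (subst (asm) mult_le_cancel_left_pos) auto
    moreover have "norm (\<psi> x) \<le> norm (\<psi> z)"
      using z finite_carrier that by (auto intro!: Max_ge)
    ultimately show ?thesis by simp
  qed
  \<comment> \<open>The values at \<open>x\<close> and \<open>\<ominus> x\<close> have product 1 and
    norm at most 1, so neither norm can be smaller.\<close>
  have "norm (\<psi> x) * norm (\<psi> (\<ominus> x)) = 1"
    using psi_add[of x "\<ominus> x"] assms by (simp add: r_neg flip: norm_mult)
  moreover have "norm (\<psi> x) * norm (\<psi> (\<ominus> x)) \<le> norm (\<psi> x) * 1"
    using le assms by (intro mult_left_mono) auto
  ultimately show ?thesis using le[of x] assms by simp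
qed

lemma psi_minus:
  assumes "x \<in> carrier R" shows "\<psi> (\<ominus> x) = cnj (\<psi> x)"
proof -
  have "\<psi> x * \<psi> (\<ominus> x) = \<psi> x * cnj (\<psi> x)"
    using psi_add[of x "\<ominus> x"] assms by (simp add: r_neg complex_norm_square[symmetric])
  then show ?thesis using psi_nonzero assms by simp
qed

lemma psi_diff:
  "x \<in> carrier R \<Longrightarrow> y \<in> carrier R \<Longrightarrow> \<psi> (x \<ominus> y) = \<psi> x * cnj (\<psi> y)"
  by (simp add: a_minus_def psi_add psi_minus)

text \<open>Translation by an element \<open>b\<close> with \<open>\<psi> b \<noteq> 1\<close>
  multiplies the sum by \<open>\<psi> b\<close>.\<close>

lemma sum_psi: "(\<Sum>x\<in>carrier R. \<psi> x) = 0"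
proof -
  obtain b where b: "b \<in> carrier R" "\<psi> b \<noteq> 1"
    using character by (auto simp: nontrivial_additive_character_def)
  have "(\<Sum>x\<in>carrier R. \<psi> (b \<oplus> x)) = (\<Sum>x\<in>carrier R. \<psi> x)"
    using b by (intro sum.reindex_bij_witness[where i = "\<lambda>x. x \<ominus> b" and j = "\<lambda>x. b \<oplus> x"])
      (auto simp: a_minus_def a_ac r_neg r_neg1 r_neg2)
  moreover have "(\<Sum>x\<in>carrier R. \<psi> (b \<oplus> x)) = \<psi> b * (\<Sum>x\<in>carrier R. \<psi> x)"
    using b by (simp add: psi_add sum_distrib_left)
  ultimately show ?thesis using b by simp
qed

text \<open>A nonzero factor \<open>y\<close> is a shift of the argument of \<open>\<alpha>\<close>.
  What is left is the full character sum 0 without its term 1 at zero.\<close>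

lemma sum_psi_alpha:
  assumes "y \<in> carrier R"
  shows "(\<Sum>a\<in>{0..<N}. \<psi> (y \<otimes> \<alpha> a)) = (if y = \<zero> then of_int N else -1)"
proof (cases "y = \<zero>")
  case True
  then show ?thesis using N_pos by simp
next
  case False
  then obtain r where r: "y = \<alpha> r" using alpha_surj assms by blast
  have "(\<Sum>a\<in>{0..<N}. \<psi> (y \<otimes> \<alpha> a)) = (\<Sum>a\<in>{0..<N}. \<psi> (\<alpha> (a + r)))"
    by (simp add: r alpha_add m_comm)
  also have "\<dots> = (\<Sum>a\<in>{0..<N}. \<psi> (\<alpha> a))"
    by (rule sum_residues_shift[OF N_pos]) (metis alpha_cong)
  also have "\<dots> = (\<Sum>x\<in>carrier R - {\<zero>}. \<psi> x)"
    by (rule sum.reindex_bij_betw[OF bij_betw_alpha])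
  also have "\<dots> = - 1"
    using finite_carrier by (subst sum_diff) (auto simp: sum_psi)
  finally show ?thesis using False by simp
qed

section \<open>Gauss sums\<close>

abbreviation e :: "int \<Rightarrow> complex" where "e \<equiv> root_char N"

definition gauss_sum :: "'a \<Rightarrow> int \<Rightarrow> complex" where
  "gauss_sum y k = (\<Sum>a\<in>{0..<N}. \<psi> (y \<otimes> \<alpha> a) * e (- (k * a)))"

lemma e_cong: "N dvd x - y \<Longrightarrow> e x = e y"
  by (rule root_char_cong[OF N_pos])

lemma e_eq_1: "N dvd x \<Longrightarrow> e x = 1"
  by (simp add: root_char_eq_1_iff[OF N_pos])

lemma gauss_sum_cong:
  assumes "N dvd k - l" shows "gauss_sum y k = gauss_sum y l"
proof -
  have "N dvd - (k * a) - - (l * a)" for a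
  proof -
    have "- (k * a) - - (l * a) = - ((k - l) * a)" by (simp add: algebra_simps)
    then show ?thesis using assms by simp
  qed
  then show ?thesis
    unfolding gauss_sum_def by (intro sum.cong refl arg_cong2[where f = "(*)"] e_cong)
qed

lemma gauss_sum_zero: "gauss_sum \<zero> k = (if N dvd k then of_int N else 0)"
  using sum_root_char'[OF N_pos, of k] by (simp add: gauss_sum_def)

lemma gauss_sum_alpha: "gauss_sum (\<alpha> r) k = e (k * r) * gauss_sum \<one> k"
proof -
  have "gauss_sum (\<alpha> r) k = (\<Sum>a\<in>{0..<N}. e (k * r) * (\<psi> (\<one> \<otimes> \<alpha> (a + r)) * e (- (k * (a + r)))))"
    unfolding gauss_sum_def
  proof (intro sum.cong refl)
    fix a
    have "e (- (k * a)) = e (k * r) * e (- (k * (a + r)))"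
      by (simp add: algebra_simps flip: root_char_add)
    then show "\<psi> (\<alpha> r \<otimes> \<alpha> a) * e (- (k * a)) = e (k * r) * (\<psi> (\<one> \<otimes> \<alpha> (a + r)) * e (- (k * (a + r))))"
      by (simp add: alpha_add m_comm)
  qed
  also have "\<dots> = e (k * r) * (\<Sum>a\<in>{0..<N}. \<psi> (\<one> \<otimes> \<alpha> (a + r)) * e (- (k * (a + r))))"
    by (simp add: sum_distrib_left)
  also have "(\<Sum>a\<in>{0..<N}. \<psi> (\<one> \<otimes> \<alpha> (a + r)) * e (- (k * (a + r)))) = gauss_sum \<one> k"
    unfolding gauss_sum_def
  proof (rule sum_residues_shift[OF N_pos])
    fix x y assume *: "N dvd x - y"
    have "- (k * x) - - (k * y) = - (k * (x - y))" by (simp add: algebra_simps)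
    then have "e (- (k * x)) = e (- (k * y))" using * by (intro e_cong) simp
    then show "\<psi> (\<one> \<otimes> \<alpha> x) * e (- (k * x)) = \<psi> (\<one> \<otimes> \<alpha> y) * e (- (k * y))"
      using alpha_cong[OF *] by simp
  qed
  finally show ?thesis .
qed

lemma norm_gauss_sum_alpha: "norm (gauss_sum (\<alpha> r) k) = norm (gauss_sum \<one> k)"
  by (simp add: gauss_sum_alpha norm_mult)

text \<open>The classical evaluation, with \<open>N + 1 = q\<close>: in the double sum the ratio
  \<open>\<alpha> c\<close> of the two arguments is held fixed and \<open>sum_psi_alpha\<close> is
  applied to the other variable.\<close>

lemma norm_gauss_sum_squared:
  "(norm (gauss_sum \<one> k))\<^sup>2 = (if N dvd k then 1 else of_int N + 1)"
proof (cases "N dvd k")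
  case True
  have "gauss_sum \<one> k = (\<Sum>a\<in>{0..<N}. \<psi> (\<one> \<otimes> \<alpha> a))"
    using True by (simp add: gauss_sum_def e_eq_1)
  then show ?thesis using True by (simp only: sum_psi_alpha[OF one_closed]) simp
next
  case False
  let ?t = "\<lambda>a. \<psi> (\<alpha> a) * e (- (k * a))"
  have per: "?t x = ?t y" if "N dvd x - y" for x y
  proof -
    have "- (k * x) - - (k * y) = - (k * (x - y))" by (simp add: algebra_simps)
    then have "e (- (k * x)) = e (- (k * y))" using that by (intro e_cong) simp
    then show ?thesis using alpha_cong[OF that] by simp
  qed
  have "of_real ((norm (gauss_sum \<one> k))\<^sup>2) = (\<Sum>a\<in>{0..<N}. ?t a) * cnj (\<Sum>b\<in>{0..<N}. ?t b)"
    unfolding complex_norm_square gauss_sum_def by simp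
  also have "\<dots> = (\<Sum>b\<in>{0..<N}. (\<Sum>a\<in>{0..<N}. ?t a) * cnj (?t b))"
    by (simp only: cnj_sum sum_distrib_left)
  also have "\<dots> = (\<Sum>b\<in>{0..<N}. (\<Sum>c\<in>{0..<N}. ?t (c + b)) * cnj (?t b))"
    by (subst sum_residues_shift[OF N_pos per]) auto
  also have "\<dots> = (\<Sum>b\<in>{0..<N}. \<Sum>c\<in>{0..<N}. \<psi> ((\<alpha> c \<ominus> \<one>) \<otimes> \<alpha> b) * e (- (k * c)))"
    unfolding sum_distrib_right
  proof (intro sum.cong refl)
    fix b c
    have "e (- (k * (c + b))) * cnj (e (- (k * b))) = e (- (k * c))"
      by (simp add: cnj_root_char algebra_simps flip: root_char_add)
    moreover have "\<psi> ((\<alpha> c \<ominus> \<one>) \<otimes> \<alpha> b) = \<psi> (\<alpha> (c + b)) * cnj (\<psi> (\<alpha> b))"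
      by (simp add: alpha_add a_minus_def l_distr l_minus psi_add psi_minus)
    ultimately show "?t (c + b) * cnj (?t b) = \<psi> ((\<alpha> c \<ominus> \<one>) \<otimes> \<alpha> b) * e (- (k * c))"
      by (simp add: mult_ac)
  qed
  also have "\<dots> = (\<Sum>c\<in>{0..<N}. (\<Sum>b\<in>{0..<N}. \<psi> ((\<alpha> c \<ominus> \<one>) \<otimes> \<alpha> b)) * e (- (k * c)))"
    by (subst sum.swap) (simp only: sum_distrib_right)
  \<comment> \<open>The inner sum is \<open>N\<close> at \<open>c = 0\<close> and -1 elsewhere, that
    is, \<open>N + 1\<close> at one point minus the constant 1; the constant disappears against a
    nontrivial character.\<close>
  also have "\<dots> = (\<Sum>c\<in>{0..<N}. (if c = 0 then of_int N + 1 else 0) - e (- (k * c)))"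
  proof (intro sum.cong refl)
    fix c assume c: "c \<in> {0..<N}"
    then have "\<alpha> c \<ominus> \<one> = \<zero> \<longleftrightarrow> c = 0"
      using alpha_eq_one_iff[OF c] by (simp add: r_right_minus_eq)
    then show "(\<Sum>b\<in>{0..<N}. \<psi> ((\<alpha> c \<ominus> \<one>) \<otimes> \<alpha> b)) * e (- (k * c)) = (if c = 0 then of_int N + 1 else 0) - e (- (k * c))"
      by (subst sum_psi_alpha) auto
  qed
  also have "\<dots> = of_int N + 1"
    using N_pos False by (simp add: sum_subtractf sum_root_char'[OF N_pos])
  finally have "complex_of_real ((norm (gauss_sum \<one> k))\<^sup>2) = complex_of_real (of_int N + 1)" by simp
  then show ?thesis using False by (simp only: of_real_eq_iff) simp
qed

section \<open>The autocorrelation and its Fourier coefficients\<close>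

text \<open>This form factors into a function of \<open>x\<close> and one of \<open>y\<close> once
  \<open>z\<close> is fixed, and is \<open>N\<close>-periodic in each variable.\<close>

definition autocorrelation :: "int \<Rightarrow> int \<Rightarrow> int \<Rightarrow> int \<Rightarrow> complex" where
  "autocorrelation t x y z = \<psi> (\<alpha> t \<otimes> (\<one> \<ominus> \<alpha> z) \<otimes> \<alpha> x) * cnj (\<psi> (\<alpha> t \<otimes> (\<one> \<ominus> \<alpha> z) \<otimes> \<alpha> y))"

lemma autocorrelation_cong:
  "N dvd x - x' \<Longrightarrow> N dvd y - y' \<Longrightarrow> N dvd z - z' \<Longrightarrow> autocorrelation t x y z = autocorrelation t x' y' z'"
  by (simp add: autocorrelation_def alpha_cong[of x x'] alpha_cong[of y y'] alpha_cong[of z z'])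

text \<open>Multiplying out \<open>\<alpha> t \<otimes> (\<one> \<ominus> \<alpha> m) \<otimes>
  \<alpha> x\<close> gives the difference of \<open>\<alpha>\<close> at \<open>x + t\<close> and
  \<open>x + m + t\<close>. With \<open>m = c - a\<close> this pairs \<open>a\<close> with
  \<open>c\<close> and \<open>d\<close> with \<open>b\<close>.\<close>

lemma autocorrelation_eq:
  assumes "a + b = c + d"
  shows "autocorrelation t a d (c - a) =
     \<psi> (\<alpha> (a + t)) * \<psi> (\<alpha> (b + t)) * cnj (\<psi> (\<alpha> (c + t))) * cnj (\<psi> (\<alpha> (d + t)))"
proof -
  have *: "\<psi> (\<alpha> t \<otimes> (\<one> \<ominus> \<alpha> z) \<otimes> \<alpha> x) = \<psi> (\<alpha> (x + t)) * cnj (\<psi> (\<alpha> (x + z + t)))" for x z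
  proof -
    have "\<alpha> t \<otimes> (\<one> \<ominus> \<alpha> z) \<otimes> \<alpha> x = \<alpha> (x + t) \<ominus> \<alpha> (x + z + t)"
      by (simp add: alpha_add a_minus_def r_distr l_distr r_minus l_minus m_ac)
    then show ?thesis by (simp add: psi_diff)
  qed
  have "d + (c - a) = b" using assms by simp
  then show ?thesis
    unfolding autocorrelation_def * by (simp add: mult_ac)
qed

lemma fourier3_autocorrelation:
  "fourier3 N (autocorrelation t) k1 k2 k3 =
    (\<Sum>z\<in>{0..<N}. gauss_sum (\<alpha> t \<otimes> (\<one> \<ominus> \<alpha> z)) k1 * cnj (gauss_sum (\<alpha> t \<otimes> (\<one> \<ominus> \<alpha> z)) (- k2))
       * e (- (k3 * z)))"
  unfolding fourier3_def gauss_sum_def cnj_sum sum_product autocorrelation_def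
  by (rule sum.cong[OF refl], rule arg_cong2[where f = "(*)", OF _ refl], subst sum.swap)
     (simp add: sum_distrib_right sum_distrib_left cnj_root_char mult_ac)

lemma norm_fourier3_autocorrelation_generic:
  assumes "\<not> N dvd k1 + k2"
  shows "norm (fourier3 N (autocorrelation t) k1 k2 k3) \<le> (of_int N + 1) * sqrt (of_int N + 1)"
proof -
  let ?Y = "\<lambda>z. \<alpha> t \<otimes> (\<one> \<ominus> \<alpha> z)"
  let ?l = "k1 + k2"
  let ?r = "sqrt (of_int N + 1)"
  let ?C = "gauss_sum \<one> k1 * cnj (gauss_sum \<one> (- k2))"
  have r1: "norm (gauss_sum \<one> k) \<le> ?r" for k
    using norm_gauss_sum_squared[of k] N_pos by (intro real_le_rsqrt) auto
  \<comment> \<open>The exact norm is required here, because this factor is divided out at the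
    end.\<close>
  have rl: "norm (gauss_sum \<one> ?l) = ?r"
    using norm_gauss_sum_squared[of ?l] assms by (intro real_sqrt_unique[symmetric]) auto
  txt \<open>Multiplying by one more Gauss sum turns the Jacobi sum over \<open>z\<close> into a product of Gauss sums, so
    its absolute value need not be computed separately.\<close>
  have factor: "gauss_sum y k1 * cnj (gauss_sum y (- k2)) * gauss_sum \<one> ?l = ?C * gauss_sum y ?l"
    if y: "y \<in> carrier R" for y
  proof (cases "y = \<zero>")
    case True
    \<comment> \<open>At \<open>y = \<zero>\<close> both sides vanish: \<open>k1\<close> and
      \<open>k2\<close> cannot both be multiples of \<open>N\<close>, nor is their sum.\<close>
    have "\<not> (N dvd k1 \<and> N dvd k2)" using assms by auto
    then show ?thesis using True assms by (auto simp: gauss_sum_zero)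
  next
    case False
    then obtain r where r: "y = \<alpha> r" using alpha_surj y by blast
    have "e (k1 * r) * cnj (e (- k2 * r)) = e (?l * r)"
      by (simp add: cnj_root_char distrib_right root_char_add)
    then show ?thesis by (simp add: r gauss_sum_alpha[of r] mult_ac)
  qed
  have "fourier3 N (autocorrelation t) k1 k2 k3 * gauss_sum \<one> ?l
     = (\<Sum>z\<in>{0..<N}. (gauss_sum (?Y z) k1 * cnj (gauss_sum (?Y z) (- k2)) * gauss_sum \<one> ?l) * e (- (k3 * z)))"
    unfolding fourier3_autocorrelation sum_distrib_right by (simp add: mult_ac)
  also have "\<dots> = ?C * (\<Sum>z\<in>{0..<N}. gauss_sum (?Y z) ?l * e (- (k3 * z)))"
    unfolding sum_distrib_left by (intro sum.cong refl, subst factor) (auto simp: mult_ac)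
  \<comment> \<open>The Gauss sum is opened and \<open>z\<close> is summed first; the sum over
    \<open>z\<close> is again a conjugated Gauss sum.\<close>
  also have "(\<Sum>z\<in>{0..<N}. gauss_sum (?Y z) ?l * e (- (k3 * z)))
      = (\<Sum>x\<in>{0..<N}. \<psi> (\<alpha> (t + x)) * e (- (?l * x)) * (\<Sum>z\<in>{0..<N}. cnj (\<psi> (\<alpha> (t + x) \<otimes> \<alpha> z)) * e (- (k3 * z))))"
  proof -
    have "\<psi> (?Y z \<otimes> \<alpha> x) = \<psi> (\<alpha> (t + x)) * cnj (\<psi> (\<alpha> (t + x) \<otimes> \<alpha> z))" for x z
    proof -
      have "?Y z \<otimes> \<alpha> x = \<alpha> (t + x) \<ominus> (\<alpha> (t + x) \<otimes> \<alpha> z)"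
        by (simp add: alpha_add a_minus_def r_distr l_distr r_minus l_minus m_ac)
      then show ?thesis by (simp add: psi_diff)
    qed
    then show ?thesis
      unfolding gauss_sum_def sum_distrib_left sum_distrib_right
      by (subst sum.swap) (simp add: mult_ac)
  qed
  also have "\<dots> = (\<Sum>x\<in>{0..<N}. \<psi> (\<alpha> (t + x)) * e (- (?l * x)) * cnj (gauss_sum (\<alpha> (t + x)) (- k3)))"
    by (simp add: gauss_sum_def cnj_root_char)
  also have "\<dots> = (\<Sum>x\<in>{0..<N}. \<psi> (\<alpha> t \<otimes> \<alpha> x) * e (- ((?l - k3) * x))) * (e (k3 * t) * cnj (gauss_sum \<one> (- k3)))"
  proof -
    have "e (- (?l * x)) * cnj (e (- k3 * (t + x))) = e (- ((?l - k3) * x)) * e (k3 * t)" for x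
      unfolding cnj_root_char root_char_add[symmetric] by (rule arg_cong[where f = e]) (simp add: algebra_simps)
    then have "e (- (?l * x)) * (cnj (e (- k3 * (t + x))) * c) = e (- ((?l - k3) * x)) * (e (k3 * t) * c)" for x c
      by (simp only: mult.assoc[symmetric])
    then show ?thesis
      unfolding sum_distrib_right gauss_sum_alpha complex_cnj_mult
      by (intro sum.cong refl) (simp only: alpha_add mult.assoc)
  qed
  also have "\<dots> = gauss_sum (\<alpha> t) (?l - k3) * (e (k3 * t) * cnj (gauss_sum \<one> (- k3)))"
    by (simp add: gauss_sum_def)
  finally have eq: "fourier3 N (autocorrelation t) k1 k2 k3 * gauss_sum \<one> ?l =
    ?C * (gauss_sum (\<alpha> t) (?l - k3) * (e (k3 * t) * cnj (gauss_sum \<one> (- k3))))" .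
  \<comment> \<open>Four Gauss sums on the right against one on the left leave the third power of
    \<open>sqrt (N + 1)\<close>.\<close>
  have "norm (fourier3 N (autocorrelation t) k1 k2 k3) * ?r
     = norm (fourier3 N (autocorrelation t) k1 k2 k3 * gauss_sum \<one> ?l)"
    by (simp add: norm_mult rl)
  also have "\<dots> \<le> ?r * ?r * (?r * (1 * ?r))"
    unfolding eq norm_mult complex_mod_cnj norm_root_char norm_gauss_sum_alpha using N_pos
    by (intro mult_mono r1 mult_nonneg_nonneg order_refl) auto
  also have "\<dots> = ((of_int N + 1) * ?r) * ?r"
    using N_pos by (simp add: mult_ac)
  finally show ?thesis using N_pos by (subst (asm) mult_le_cancel_right) auto
qed

text \<open>Here the two Gauss sums are conjugate, so the summand is a squared norm:
  \<open>h\<close> at \<open>z = 0\<close>, and the constant \<open>g\<close> at all other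
  \<open>z\<close>. Coefficients of order \<open>N^2\<close> arise only in this case.\<close>

lemma fourier3_autocorrelation_special:
  assumes "N dvd k1 + k2"
  shows "fourier3 N (autocorrelation t) k1 k2 k3 =
    (if N dvd k1 then 1 else of_int N + 1) * ((if N dvd k3 then of_int N else 0) - 1)
     + (if N dvd k1 then of_int N ^ 2 else 0)"
proof -
  let ?Y = "\<lambda>z. \<alpha> t \<otimes> (\<one> \<ominus> \<alpha> z)"
  define g :: complex where "g = (if N dvd k1 then 1 else of_int N + 1)"
  define h :: complex where "h = (if N dvd k1 then of_int N ^ 2 else 0)"
  have k2: "gauss_sum y (- k2) = gauss_sum y k1" for y
  proof (rule gauss_sum_cong)
    have "- k2 - k1 = - (k1 + k2)" by simp
    then show "N dvd - k2 - k1" using assms by (simp only: dvd_minus_iff)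
  qed
  have sq: "gauss_sum (?Y z) k1 * cnj (gauss_sum (?Y z) k1) = (if z = 0 then h else g)"
    if z: "z \<in> {0..<N}" for z
  proof -
    have Y: "?Y z \<in> carrier R" by simp
    have "?Y z = \<zero> \<longleftrightarrow> z = 0"
      using alpha_eq_one_iff[OF z] by (auto simp: integral_iff r_right_minus_eq)
    show ?thesis
    proof (cases "z = 0")
      case True
      then have "?Y z = \<zero>" using \<open>?Y z = \<zero> \<longleftrightarrow> z = 0\<close> by simp
      then show ?thesis using True by (simp add: gauss_sum_zero h_def power2_eq_square)
    next
      case False
      then obtain r where "?Y z = \<alpha> r" using Y alpha_surj \<open>?Y z = \<zero> \<longleftrightarrow> z = 0\<close> by blast
      then have "gauss_sum (?Y z) k1 * cnj (gauss_sum (?Y z) k1) = of_real ((norm (gauss_sum \<one> k1))\<^sup>2)"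
        by (simp add: norm_gauss_sum_alpha flip: complex_norm_square)
      then show ?thesis unfolding norm_gauss_sum_squared using False by (simp add: g_def)
    qed
  qed
  have "fourier3 N (autocorrelation t) k1 k2 k3 = (\<Sum>z\<in>{0..<N}. (if z = 0 then h else g) * e (- (k3 * z)))"
    unfolding fourier3_autocorrelation k2 by (intro sum.cong refl) (simp only: sq)
  also have "\<dots> = (\<Sum>z\<in>{0..<N}. (if z = 0 then h - g else 0) + g * e (- (k3 * z)))"
    by (intro sum.cong refl) auto
  also have "\<dots> = h - g + g * (if N dvd k3 then of_int N else 0)"
    using N_pos by (simp add: sum.distrib sum_root_char'[OF N_pos] flip: sum_distrib_left)
  finally show ?thesis by (simp add: g_def h_def algebra_simps)
qed

text \<open>The two indicators remove the coefficients of order \<open>N^2\<close>. At frequency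
  zero they remove one \<open>N^2\<close> too many, which the constant \<open>1 / N\<close>
  restores.\<close>

definition residual :: "int \<Rightarrow> int \<Rightarrow> int \<Rightarrow> int \<Rightarrow> complex" where
  "residual t x y z = autocorrelation t x y z - of_bool (N dvd z) - of_bool (N dvd x - y) + 1 / of_int N"

lemma residual_cong:
  assumes "N dvd x - x'" "N dvd y - y'" "N dvd z - z'"
  shows "residual t x y z = residual t x' y' z'"
proof -
  have "N dvd z \<longleftrightarrow> N dvd z'" using assms(3) by (metis mod_eq_dvd_iff dvd_eq_mod_eq_0)
  moreover have "N dvd x - y \<longleftrightarrow> N dvd x' - y'"
    using assms(1,2) by (metis mod_diff_cong mod_eq_dvd_iff)
  ultimately show ?thesis
    using autocorrelation_cong[OF assms] by (simp add: residual_def)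
qed

lemma norm_fourier3_residual:
  "norm (fourier3 N (residual t) k1 k2 k3) \<le> (of_int N + 1) * sqrt (of_int N + 1)"
proof -
  let ?b = "\<lambda>k. if N dvd k then of_int N else (0 :: complex)"
  have single: "y \<in> {0..<N} \<Longrightarrow> N dvd y \<longleftrightarrow> y = 0" for y
    by (auto dest: zdvd_imp_le)
  have z: "fourier3 N (\<lambda>x y z. of_bool (N dvd z)) k1 k2 k3 = ?b k1 * ?b k2"
  proof -
    have "fourier3 N (\<lambda>x y z. of_bool (N dvd z)) k1 k2 k3
        = (\<Sum>z\<in>{0..<N}. of_bool (N dvd z) * ?b k1 * ?b k2 * e (- (k3 * z)))"
      unfolding fourier3_def
      by (simp add: sum_root_char'[OF N_pos] flip: sum_distrib_left sum_distrib_right)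
    also have "\<dots> = (\<Sum>z\<in>{0..<N}. if z = 0 then ?b k1 * ?b k2 else 0)"
      by (intro sum.cong refl) (auto simp: single)
    finally show ?thesis using N_pos by simp
  qed
  have xy: "fourier3 N (\<lambda>x y z. of_bool (N dvd x - y)) k1 k2 k3 = ?b (k1 + k2) * ?b k3"
  proof -
    have "(\<Sum>x\<in>{0..<N}. of_bool (N dvd x - y) * e (- (k1 * x))) = e (- (k1 * y))"
      if y: "y \<in> {0..<N}" for y
    proof -
      have "(\<Sum>x\<in>{0..<N}. of_bool (N dvd x - y) * e (- (k1 * x))) = (\<Sum>x\<in>{0..<N}. if x = y then e (- (k1 * x)) else 0)"
        using y by (intro sum.cong refl) (auto simp flip: mod_eq_dvd_iff)
      then show ?thesis using y by simp
    qed
    then have "fourier3 N (\<lambda>x y z. of_bool (N dvd x - y)) k1 k2 k3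
       = (\<Sum>z\<in>{0..<N}. (\<Sum>y\<in>{0..<N}. e (- (k1 * y)) * e (- (k2 * y))) * e (- (k3 * z)))"
      unfolding fourier3_def by simp
    also have "\<dots> = (\<Sum>y\<in>{0..<N}. e (- ((k1 + k2) * y))) * (\<Sum>z\<in>{0..<N}. e (- (k3 * z)))"
      unfolding sum_distrib_left by (simp add: distrib_right flip: root_char_add)
    finally show ?thesis by (simp only: sum_root_char'[OF N_pos])
  qed
  have const: "fourier3 N (\<lambda>x y z. 1 / of_int N) k1 k2 k3 = ?b k1 * ?b k2 * ?b k3 / of_int N"
    unfolding fourier3_def
    by (simp add: sum_root_char'[OF N_pos] flip: sum_distrib_left sum_distrib_right sum_divide_distrib)
  have eq: "fourier3 N (residual t) k1 k2 k3 = fourier3 N (autocorrelation t) k1 k2 k3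
     - ?b k1 * ?b k2 - ?b (k1 + k2) * ?b k3 + ?b k1 * ?b k2 * ?b k3 / of_int N"
    unfolding const[symmetric] unfolding z[symmetric] xy[symmetric]
    unfolding fourier3_def residual_def by (simp only: distrib_right left_diff_distrib sum.distrib sum_subtractf)
  show ?thesis
  proof (cases "N dvd k1 + k2")
    case False
    \<comment> \<open>Off \<open>N dvd k1 + k2\<close> none of the subtracted functions has a
      Fourier coefficient, so the generic bound carries over.\<close>
    then have 0: "?b k1 * ?b k2 = 0" "?b (k1 + k2) = 0" by auto
    show ?thesis
      using norm_fourier3_autocorrelation_generic[OF False] unfolding eq 0 by simp
  next
    case True
    then have k2: "N dvd k2 \<longleftrightarrow> N dvd k1" by (metis dvd_add_right_iff dvd_add_left_iff)
    have "norm (fourier3 N (residual t) k1 k2 k3) \<le> of_int N + 1"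
    proof -
      consider "N dvd k1" "N dvd k3" | "N dvd k1" "\<not> N dvd k3" | "\<not> N dvd k1" "N dvd k3" | "\<not> N dvd k1" "\<not> N dvd k3" by blast
      then show ?thesis
      proof cases
        case 1
        then have "fourier3 N (residual t) k1 k2 k3 = of_int (N - 1)"
          using True k2 N_pos unfolding eq fourier3_autocorrelation_special[OF True]
          by (simp add: power2_eq_square)
        then show ?thesis using N_pos by (simp only: norm_of_int; simp)
      next
        case 2
        then have "fourier3 N (residual t) k1 k2 k3 = -1"
          using True k2 N_pos unfolding eq fourier3_autocorrelation_special[OF True]
          by (simp add: power2_eq_square)
        then show ?thesis using N_pos by simp
      next
        case 3
        then have "fourier3 N (residual t) k1 k2 k3 = -1"
          using True k2 N_pos unfolding eq fourier3_autocorrelation_special[OF True]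
          by (simp add: algebra_simps)
        then show ?thesis using N_pos by simp
      next
        case 4
        then have "fourier3 N (residual t) k1 k2 k3 = of_int (- (N + 1))"
          using True k2 N_pos unfolding eq fourier3_autocorrelation_special[OF True]
          by simp
        then show ?thesis using N_pos by (simp only: norm_of_int; simp)
      qed
    qed
    also have "\<dots> \<le> (of_int N + 1) * sqrt (of_int N + 1)"
      using N_pos by (simp add: mult_le_cancel_left1)
    finally show ?thesis .
  qed
qed

lemma sum_autocorrelation_approx:
  assumes "s \<ge> 0"
  shows "norm ((\<Sum>(a, b, c, d)\<in>additive_quads s. autocorrelation t a d (c - a))
      - (of_nat (card {(a, b, c, d) \<in> additive_quads s. N dvd c - a})
         + of_nat (card {(a, b, c, d) \<in> additive_quads s. N dvd a - d})
         - of_nat (card (additive_quads s)) / of_int N))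
    \<le> (of_int N + 1) * sqrt (of_int N + 1) * (2 * of_int s / of_int N + harm (nat N)) ^ 4"
proof -
  have "norm (\<Sum>(a, b, c, d)\<in>additive_quads s. residual t a d (c - a))
     \<le> (of_int N + 1) * sqrt (of_int N + 1) * (2 * of_int s / of_int N + harm (nat N)) ^ 4"
    by (rule sum_additive_quads_le[OF N_pos assms residual_cong norm_fourier3_residual])
  also have "(\<Sum>(a, b, c, d)\<in>additive_quads s. residual t a d (c - a)) =
     (\<Sum>(a, b, c, d)\<in>additive_quads s. autocorrelation t a d (c - a))
     - (\<Sum>(a, b, c, d)\<in>additive_quads s. of_bool (N dvd c - a))
     - (\<Sum>(a, b, c, d)\<in>additive_quads s. of_bool (N dvd a - d))
     + of_nat (card (additive_quads s)) / of_int N"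
    by (simp add: residual_def split_def sum.distrib sum_subtractf)
  also have "(\<Sum>(a, b, c, d)\<in>additive_quads s. of_bool (N dvd c - a)) =
      complex_of_nat (card {(a, b, c, d) \<in> additive_quads s. N dvd c - a})"
    by (simp add: split_def of_bool_def sum.If_cases Int_def conj_commute)
  also have "(\<Sum>(a, b, c, d)\<in>additive_quads s. of_bool (N dvd a - d)) =
      complex_of_nat (card {(a, b, c, d) \<in> additive_quads s. N dvd a - d})"
    by (simp add: split_def of_bool_def sum.If_cases Int_def conj_commute)
  finally show ?thesis by (simp add: algebra_simps)
qed

end

section \<open>Norms on the unit circle\<close>

lemma has_integral_cis_int:
  "((\<lambda>\<theta>. cis (of_int n * \<theta>)) has_integral (if n = 0 then 2 * of_real pi else 0)) {0..2 * pi}"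
proof (cases "n = 0")
  case True
  then show ?thesis using has_integral_const_real[of "1::complex" 0 "2 * pi"] by (simp add: scaleR_conv_of_real)
next
  case False
  have "((\<lambda>\<theta>. cis (of_int n * \<theta>)) has_integral
     (cis (of_int n * (2 * pi)) / (\<i> * of_int n) - cis (of_int n * 0) / (\<i> * of_int n))) {0..2 * pi}"
  proof (rule fundamental_theorem_of_calculus)
    fix x :: real
    let ?c = "\<i> * of_int n"
    have "((\<lambda>z. exp (?c * z) / ?c) has_field_derivative exp (?c * of_real x)) (at (of_real x))"
      using False by (auto intro!: derivative_eq_intros)
    from has_vector_derivative_real_field[OF this, of "{0..2 * pi}"]
    show "((\<lambda>\<theta>. cis (of_int n * \<theta>) / (\<i> * of_int n)) has_vector_derivative cis (of_int n * x)) (at x within {0..2 * pi})"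
      by (simp add: cis_conv_exp mult.assoc)
  qed simp
  moreover have "cis (of_int n * (2 * pi)) = 1"
    using cis_multiple_2pi[of "of_int n"] by (simp add: mult.commute)
  ultimately show ?thesis using False by simp
qed

text \<open>Indexed by integers, to match the quadruples and the arguments of
  \<open>\<alpha>\<close>.\<close>

definition trig_poly :: "int \<Rightarrow> (int \<Rightarrow> complex) \<Rightarrow> real \<Rightarrow> complex" where
  "trig_poly s u \<theta> = (\<Sum>a\<in>{0..<s}. u a * cis (of_int a * \<theta>))"

lemma has_integral_trig_poly_2:
  "((\<lambda>\<theta>. norm (trig_poly s u \<theta>) ^ 2) has_integral 2 * pi * (\<Sum>a\<in>{0..<s}. norm (u a) ^ 2)) {0..2 * pi}"
proof -
  have "complex_of_real (norm (trig_poly s u \<theta>) ^ 2) = (\<Sum>a\<in>{0..<s}. \<Sum>b\<in>{0..<s}. u a * cnj (u b) * cis (of_int (a - b) * \<theta>))" for \<theta>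
    unfolding complex_norm_square trig_poly_def cnj_sum sum_product
  proof (intro sum.cong refl)
    fix a b
    have "cis (of_int (a - b) * \<theta>) = cis (of_int a * \<theta>) * cnj (cis (of_int b * \<theta>))"
      unfolding cis_cnj cis_mult by (rule arg_cong[where f = cis]) (simp add: algebra_simps)
    then show "u a * cis (of_int a * \<theta>) * cnj (u b * cis (of_int b * \<theta>)) = u a * cnj (u b) * cis (of_int (a - b) * \<theta>)"
      by (simp add: mult_ac)
  qed
  moreover have "((\<lambda>\<theta>. \<Sum>a\<in>{0..<s}. \<Sum>b\<in>{0..<s}. u a * cnj (u b) * cis (of_int (a - b) * \<theta>)) has_integral
     (\<Sum>a\<in>{0..<s}. \<Sum>b\<in>{0..<s}. u a * cnj (u b) * (if a - b = 0 then 2 * of_real pi else 0))) {0..2 * pi}"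
    by (intro has_integral_sum has_integral_mult_right has_integral_cis_int) auto
  moreover have "(\<Sum>a\<in>{0..<s}. \<Sum>b\<in>{0..<s}. u a * cnj (u b) * (if a - b = 0 then 2 * of_real pi else 0)) =
    complex_of_real (2 * pi * (\<Sum>a\<in>{0..<s}. norm (u a) ^ 2))"
  proof -
    have "(\<Sum>b\<in>{0..<s}. u a * cnj (u b) * (if a - b = 0 then 2 * of_real pi else 0)) = complex_of_real (2 * pi * norm (u a) ^ 2)"
      if "a \<in> {0..<s}" for a
    proof -
      have "(\<Sum>b\<in>{0..<s}. u a * cnj (u b) * (if a - b = 0 then 2 * of_real pi else 0)) =
        (\<Sum>b\<in>{0..<s}. if b = a then u a * cnj (u a) * (2 * of_real pi) else 0)"
        by (intro sum.cong refl) auto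
      also have "\<dots> = u a * cnj (u a) * (2 * of_real pi)" using that by simp
      finally show ?thesis by (simp add: complex_norm_square[symmetric] mult_ac)
    qed
    then show ?thesis by (simp add: sum_distrib_left)
  qed
  ultimately have "((\<lambda>\<theta>. complex_of_real (norm (trig_poly s u \<theta>) ^ 2)) has_integral
     complex_of_real (2 * pi * (\<Sum>a\<in>{0..<s}. norm (u a) ^ 2))) {0..2 * pi}"
    by simp
  from has_integral_Re[OF this] show ?thesis by (simp only: Re_complex_of_real)
qed

lemma trig_poly_4:
  "complex_of_real (norm (trig_poly s u \<theta>) ^ 4) =
    (\<Sum>(a, b, c, d)\<in>{0..<s} \<times> {0..<s} \<times> {0..<s} \<times> {0..<s}.
      u a * u b * cnj (u c) * cnj (u d) * cis (of_int (a + b - c - d) * \<theta>))"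
proof -
  let ?f = "\<lambda>a. u a * cis (of_int a * \<theta>)"
  let ?T = "trig_poly s u \<theta>"
  have "complex_of_real (norm ?T ^ 4) = (of_real (norm ?T ^ 2)) ^ 2"
    by (simp flip: power_mult)
  also have "\<dots> = ?T * ?T * cnj ?T * cnj ?T"
    unfolding complex_norm_square by (simp add: power2_eq_square mult_ac)
  also have "\<dots> = (\<Sum>(a, b, c, d)\<in>{0..<s} \<times> {0..<s} \<times> {0..<s} \<times> {0..<s}. ?f a * ?f b * cnj (?f c) * cnj (?f d))"
    unfolding trig_poly_def cnj_sum by (rule sum_times4[symmetric])
  also have "\<dots> = (\<Sum>(a, b, c, d)\<in>{0..<s} \<times> {0..<s} \<times> {0..<s} \<times> {0..<s}.
      u a * u b * cnj (u c) * cnj (u d) * cis (of_int (a + b - c - d) * \<theta>))"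
  proof (intro sum.cong refl, clarify)
    fix a b c d
    have "cis (of_int (a + b - c - d) * \<theta>) = cis (of_int a * \<theta>) * cis (of_int b * \<theta>) * cnj (cis (of_int c * \<theta>)) * cnj (cis (of_int d * \<theta>))"
      unfolding cis_cnj cis_mult by (rule arg_cong[where f = cis]) (simp add: algebra_simps)
    then show "?f a * ?f b * cnj (?f c) * cnj (?f d) = u a * u b * cnj (u c) * cnj (u d) * cis (of_int (a + b - c - d) * \<theta>)"
      by (simp add: mult_ac)
  qed
  finally show ?thesis .
qed

text \<open>Orthogonality on the circle keeps exactly the frequencies
  \<open>a + b - c - d = 0\<close>. The complex sum is the integral of a real function up to
  \<open>2 * pi\<close>, so passing to \<open>Re\<close> loses nothing.\<close>

lemma has_integral_trig_poly_4:
  "((\<lambda>\<theta>. norm (trig_poly s u \<theta>) ^ 4) has_integral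
     2 * pi * Re (\<Sum>(a, b, c, d)\<in>additive_quads s. u a * u b * cnj (u c) * cnj (u d))) {0..2 * pi}"
proof -
  let ?box = "{0..<s} \<times> {0..<s} \<times> {0..<s} \<times> {0..<s}"
  have "((\<lambda>\<theta>. complex_of_real (norm (trig_poly s u \<theta>) ^ 4)) has_integral
     (\<Sum>(a, b, c, d)\<in>?box. u a * u b * cnj (u c) * cnj (u d) * (if a + b - c - d = 0 then 2 * of_real pi else 0))) {0..2 * pi}"
    unfolding trig_poly_4 split_def
    by (intro has_integral_sum has_integral_mult_right has_integral_cis_int) auto
  also have "(\<Sum>(a, b, c, d)\<in>?box. u a * u b * cnj (u c) * cnj (u d) * (if a + b - c - d = 0 then 2 * of_real pi else 0))
     = 2 * of_real pi * (\<Sum>(a, b, c, d)\<in>additive_quads s. u a * u b * cnj (u c) * cnj (u d))"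
  proof -
    have "additive_quads s = {p \<in> ?box. case p of (a, b, c, d) \<Rightarrow> a + b = c + d}"
      by (auto simp: additive_quads_def)
    then show ?thesis
      by (simp only: sum_distrib_left) (subst sum.inter_filter, auto intro!: sum.cong)
  qed
  finally show ?thesis
    by (drule_tac has_integral_Re) (simp only: Re_complex_of_real, simp)
qed

lemma poly_cis_eq_trig_poly:
  "poly (\<Sum>j\<in>{..<s}. Polynomial.monom (u (int j)) j) (cis \<theta>) = trig_poly (int s) u \<theta>"
proof -
  have "trig_poly (int s) u \<theta> = (\<Sum>j\<in>{..<s}. u (int j) * cis (real j * \<theta>))"
    unfolding trig_poly_def
    by (rule sum.reindex_bij_witness[where i = int and j = nat]) auto
  then show ?thesis by (simp add: poly_sum poly_monom flip: Complex.DeMoivre)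
qed

lemma circle_norm_power:
  assumes "r > 0" "((\<lambda>\<theta>. norm (poly f (cis \<theta>)) ^ r) has_integral 2 * pi * X) {0..2 * pi}"
  shows "circle_norm (real r) f ^ r = X"
proof -
  have pw: "norm z powr real r = norm z ^ r" for z :: complex
    using assms(1) by (cases "z = 0") (auto simp: powr_realpow)
  have "X \<ge> 0"
    using has_integral_nonneg[OF assms(2)] pi_gt_zero by (auto simp: zero_le_mult_iff)
  have "circle_norm (real r) f = X powr (1 / real r)"
    using assms(2) by (simp add: circle_norm_def pw integral_unique)
  also have "\<dots> ^ r = X"
    using \<open>X \<ge> 0\<close> assms(1) by (cases "X = 0") (auto simp: powr_powr simp flip: powr_realpow)
  finally show ?thesis .
qed

section \<open>Asymptotics of the norm ratio\<close>

text \<open>The sequence \<open>harm n - ln n\<close> decreases from its value 1 at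
  \<open>n = 1\<close>.\<close>

lemma harm_le_ln: "n > 0 \<Longrightarrow> harm n \<le> 1 + ln (real n)"
  using euler_mascheroni_sequence_decreasing[of 1 n] by (simp add: harm_expand)

text \<open>Since \<open>\<psi>\<close> has norm 1, the squared \<open>L^2\<close> norm is
  \<open>s\<close>, and the quadruple sum is divided by \<open>s^2\<close>. The term
  \<open>1 / (3 * \<rho> * n^2)\<close> comes from the lower-order part of the count of all
  quadruples.\<close>

lemma (in finite_field_arrangement) ratio_approx:
  assumes s: "s > 0" and f: "f = (\<Sum>j\<in>{..<s}. Polynomial.monom (\<psi> (\<alpha> (int j + t))) j)"
  defines "n \<equiv> real_of_int N" and "\<rho> \<equiv> real s / real_of_int N"
  shows "\<bar>circle_norm 4 f ^ 4 / circle_norm 2 f ^ 4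
      - (2 * Omega (1 / \<rho>) 0 - (2 / 3 * \<rho> + 1 / (3 * \<rho> * n\<^sup>2)))\<bar>
    \<le> (n + 1) * sqrt (n + 1) / n\<^sup>2 * (2 * \<rho> + harm (nat N)) ^ 4 / \<rho>\<^sup>2"
proof -
  let ?u = "\<lambda>a. \<psi> (\<alpha> (a + t))"
  let ?n = "real_of_int N" and ?s = "real s"
  define T where "T = (\<Sum>(a, b, c, d)\<in>additive_quads (int s). ?u a * ?u b * cnj (?u c) * cnj (?u d))"
  have n: "?n > 0" using N_pos by simp
  have poly: "poly f (cis \<theta>) = trig_poly (int s) ?u \<theta>" for \<theta>
    unfolding f by (rule poly_cis_eq_trig_poly)
  have "circle_norm (real 2) f ^ 2 = (\<Sum>a\<in>{0..<int s}. norm (?u a) ^ 2)"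
    by (rule circle_norm_power, simp, unfold poly, rule has_integral_trig_poly_2)
  then have "circle_norm 2 f ^ 2 = ?s" by simp
  then have norm2: "circle_norm 2 f ^ 4 = ?s\<^sup>2"
    by (metis mult_2 numeral_Bit0 power2_eq_square power_add)
  have "circle_norm (real 4) f ^ 4 = Re T"
    unfolding T_def by (rule circle_norm_power, simp, unfold poly, rule has_integral_trig_poly_4)
  then have norm4: "circle_norm 4 f ^ 4 = Re T" by simp
  define A where "A = ?s\<^sup>2 * Omega (?n / ?s) 0"
  define C where "C = ?s * (2 * ?s\<^sup>2 + 1) / 3 / ?n"
  have "T = (\<Sum>(a, b, c, d)\<in>additive_quads (int s). autocorrelation t a d (c - a))"
    unfolding T_def by (intro sum.cong refl, clarify, subst autocorrelation_eq) (auto simp: additive_quads_def)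
  moreover define c1 where "c1 = card {(a, b, c, d) \<in> additive_quads (int s). N dvd c - a}"
  moreover define c2 where "c2 = card {(a, b, c, d) \<in> additive_quads (int s). N dvd a - d}"
  moreover define c3 where "c3 = card (additive_quads (int s))"
  moreover have "complex_of_real (2 * A - C) = of_nat c1 + of_nat c2 - of_nat c3 / of_int N"
  proof -
    have "real c1 = A"
      using card_additive_quads_dvd[OF N_pos, of "int s"] s unfolding c1_def A_def by simp
    moreover have "c2 = c1"
      unfolding c1_def c2_def by (rule card_additive_quads_swap)
    moreover have "real c3 / ?n = C"
      unfolding c3_def C_def card_additive_quads ..
    ultimately have "2 * A - C = real c1 + real c2 - real c3 / ?n" by simp
    then show ?thesis by simp
  qed
  ultimately have "norm (T - complex_of_real (2 * A - C))
      \<le> (?n + 1) * sqrt (?n + 1) * (2 * ?s / ?n + harm (nat N)) ^ 4"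
    using sum_autocorrelation_approx[of "int s" t] by simp
  moreover have "\<bar>Re T - (2 * A - C)\<bar> \<le> norm (T - complex_of_real (2 * A - C))"
    using abs_Re_le_cmod[of "T - complex_of_real (2 * A - C)"] by simp
  ultimately have "\<bar>Re T - (2 * A - C)\<bar> / ?s\<^sup>2 \<le> (?n + 1) * sqrt (?n + 1) * (2 * ?s / ?n + harm (nat N)) ^ 4 / ?s\<^sup>2"
    by (intro divide_right_mono) auto
  also have "\<dots> = (n + 1) * sqrt (n + 1) / n\<^sup>2 * (2 * \<rho> + harm (nat N)) ^ 4 / \<rho>\<^sup>2"
    using n s by (simp add: n_def \<rho>_def field_simps)
  also have "\<bar>Re T - (2 * A - C)\<bar> / ?s\<^sup>2 = \<bar>(Re T - (2 * A - C)) / ?s\<^sup>2\<bar>"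
    by (simp add: abs_divide)
  also have "(Re T - (2 * A - C)) / ?s\<^sup>2 = Re T / ?s\<^sup>2 - (2 * Omega (1 / \<rho>) 0 - (2 / 3 * \<rho> + 1 / (3 * \<rho> * n\<^sup>2)))"
    using n s by (simp add: A_def C_def n_def \<rho>_def field_simps power2_eq_square)
  finally show ?thesis by (simp only: norm2 norm4)
qed

lemma additive_character_polynomial_ratio:
  fixes F :: "('a, 'm) ring_scheme"
  assumes "additive_character_polynomial F S f"
  defines "n \<equiv> real (card (carrier F)) - 1" and "\<rho> \<equiv> real (card S) / (real (card (carrier F)) - 1)"
  shows "1 < card (carrier F)" and "0 < \<rho>"
    and "\<bar>circle_norm 4 f ^ 4 / circle_norm 2 f ^ 4
        - (2 * Omega (1 / \<rho>) 0 - (2 / 3 * \<rho> + 1 / (3 * \<rho> * n\<^sup>2)))\<bar>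
      \<le> (n + 1) * sqrt (n + 1) / n\<^sup>2 * (2 * \<rho> + harm (card (carrier F) - 1)) ^ 4 / \<rho>\<^sup>2"
proof -
  obtain s \<psi> t \<alpha> where F: "finite_field F" and s: "s \<ge> 1" "S = {..<s}"
    and \<psi>: "nontrivial_additive_character F \<psi>"
    and \<alpha>: "\<alpha> \<in> epi integer_group (units_of F)"
    and f: "f = (\<Sum>j\<in>S. Polynomial.monom (\<psi> (\<alpha> (int j + t))) j)"
    using assms(1) unfolding additive_character_polynomial_def by blast
  let ?N = "int (card (carrier F)) - 1"
  have loc: "finite_field_arrangement F \<alpha> \<psi> ?N"
    using F \<psi> \<alpha> unfolding finite_field_def finite_field_arrangement_def finite_field_arrangement_axioms_def
    by simp
  have N: "real_of_int ?N = n" "nat ?N = card (carrier F) - 1" by (simp_all add: n_def)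
  have r: "real s / n = \<rho>" by (simp add: \<rho>_def n_def s)
  show q: "1 < card (carrier F)" using finite_field_arrangement.N_pos[OF loc] by simp
  show "0 < \<rho>" using q s by (simp add: \<rho>_def)
  show "\<bar>circle_norm 4 f ^ 4 / circle_norm 2 f ^ 4
        - (2 * Omega (1 / \<rho>) 0 - (2 / 3 * \<rho> + 1 / (3 * \<rho> * n\<^sup>2)))\<bar>
      \<le> (n + 1) * sqrt (n + 1) / n\<^sup>2 * (2 * \<rho> + harm (card (carrier F) - 1)) ^ 4 / \<rho>\<^sup>2"
    using finite_field_arrangement.ratio_approx[OF loc, of s f t] s(1) f unfolding N r s(2) by simp
qed

text \<open>The error has order \<open>q powr (-1/2)\<close> times a fourth power of a
  logarithm.\<close>

lemma error_tendsto_0: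
  "((\<lambda>q::nat. real q * sqrt (real q) / (real q - 1)\<^sup>2 * (c + ln (real q - 1)) ^ 4) \<longlongrightarrow> 0) at_top"
  by real_asymp

lemma circle_norm_ratio_tendsto:
  fixes I :: "'i set"
    and F :: "'i \<Rightarrow> ('a, 'm) ring_scheme"
  assumes f: "\<And>\<iota>. \<iota> \<in> I \<Longrightarrow> additive_character_polynomial (F \<iota>) (S \<iota>) (f \<iota>)"
    and stable: "size_stable I F S \<sigma>"
  shows "((\<lambda>\<iota>. circle_norm 4 (f \<iota>) ^ 4 / circle_norm 2 (f \<iota>) ^ 4) \<longlongrightarrow> limit_ratio \<sigma>)
    (size_to_infinity I (\<lambda>\<iota>. card (carrier (F \<iota>))))"
proof -
  define q where "q = (\<lambda>\<iota>. card (carrier (F \<iota>)))"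
  define Fil where "Fil = size_to_infinity I q"
  define \<rho> where "\<rho> = (\<lambda>\<iota>. real (card (S \<iota>)) / (real (q \<iota>) - 1))"
  define n where "n = (\<lambda>\<iota>. real (q \<iota>) - 1)"
  define ratio where "ratio = (\<lambda>\<iota>. circle_norm 4 (f \<iota>) ^ 4 / circle_norm 2 (f \<iota>) ^ 4)"
  define approx where "approx = (\<lambda>\<iota>. 2 * Omega (1 / \<rho> \<iota>) 0 - (2 / 3 * \<rho> \<iota> + 1 / (3 * \<rho> \<iota> * (n \<iota>)\<^sup>2)))"
  have \<sigma>: "\<sigma> > 0" and \<rho>: "(\<rho> \<longlongrightarrow> \<sigma>) Fil"
    using stable by (simp_all add: size_stable_def \<rho>_def q_def Fil_def)
  have q: "filterlim q at_top Fil"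
    unfolding Fil_def size_to_infinity_def by (rule filterlim_mono[OF filterlim_filtercomap order_refl inf_le1])
  then have n: "filterlim n at_top Fil"
    unfolding n_def by (rule filterlim_compose[rotated]) real_asymp
  have ev_I: "\<forall>\<^sub>F \<iota> in Fil. \<iota> \<in> I"
    by (simp add: Fil_def size_to_infinity_def eventually_inf_principal)
  \<comment> \<open>Any bound above \<open>\<sigma>\<close> would do; a fixed one makes the error a
    function of \<open>q\<close> alone, apart from the division by the square of
    \<open>\<rho>\<close>.\<close>
  have ev_\<rho>: "\<forall>\<^sub>F \<iota> in Fil. \<rho> \<iota> < \<sigma> + 1" using \<rho> by (intro order_tendstoD(2)[OF \<rho>]) simp
  have bound: "\<bar>ratio \<iota> - approx \<iota>\<bar>
      \<le> (n \<iota> + 1) * sqrt (n \<iota> + 1) / (n \<iota>)\<^sup>2 * (2 * \<rho> \<iota> + harm (q \<iota> - 1)) ^ 4 / (\<rho> \<iota>)\<^sup>2"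
    and pos: "0 < \<rho> \<iota>" "1 < q \<iota>" if "\<iota> \<in> I" for \<iota>
    using additive_character_polynomial_ratio[OF f[OF that]]
    by (simp_all add: ratio_def approx_def \<rho>_def n_def q_def)
  have "((\<lambda>\<iota>. ratio \<iota> - approx \<iota>) \<longlongrightarrow> 0) Fil"
  proof (rule Lim_null_comparison)
    let ?g = "\<lambda>k::nat. real k * sqrt (real k) / (real k - 1)\<^sup>2 * (2 * (\<sigma> + 1) + 1 + ln (real k - 1)) ^ 4"
    show "\<forall>\<^sub>F \<iota> in Fil. norm (ratio \<iota> - approx \<iota>) \<le> ?g (q \<iota>) / (\<rho> \<iota>)\<^sup>2"
      using ev_I ev_\<rho>
    proof eventually_elim
      case (elim \<iota>)
      note p = pos[OF elim(1)]
      have "harm (q \<iota> - 1) \<le> 1 + ln (n \<iota>)"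
        using harm_le_ln[of "q \<iota> - 1"] p by (simp add: n_def of_nat_diff)
      then have "(2 * \<rho> \<iota> + harm (q \<iota> - 1)) ^ 4 \<le> (2 * (\<sigma> + 1) + 1 + ln (n \<iota>)) ^ 4"
        using elim(2) p by (intro power_mono) (auto intro: add_nonneg_nonneg harm_nonneg)
      then have "(n \<iota> + 1) * sqrt (n \<iota> + 1) / (n \<iota>)\<^sup>2 * (2 * \<rho> \<iota> + harm (q \<iota> - 1)) ^ 4 / (\<rho> \<iota>)\<^sup>2
        \<le> (n \<iota> + 1) * sqrt (n \<iota> + 1) / (n \<iota>)\<^sup>2 * (2 * (\<sigma> + 1) + 1 + ln (n \<iota>)) ^ 4 / (\<rho> \<iota>)\<^sup>2"
        using p by (intro divide_right_mono mult_left_mono) (auto simp: n_def)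
      with bound[OF elim(1)] show ?case by (simp add: n_def)
    qed
    have "((\<lambda>\<iota>. ?g (q \<iota>)) \<longlongrightarrow> 0) Fil"
      by (rule filterlim_compose[OF error_tendsto_0 q])
    then have "((\<lambda>\<iota>. ?g (q \<iota>) / (\<rho> \<iota>)\<^sup>2) \<longlongrightarrow> 0 / \<sigma>\<^sup>2) Fil"
      using \<sigma> by (intro tendsto_intros \<rho>) auto
    then show "((\<lambda>\<iota>. ?g (q \<iota>) / (\<rho> \<iota>)\<^sup>2) \<longlongrightarrow> 0) Fil" by simp
  qed
  moreover have "(approx \<longlongrightarrow> limit_ratio \<sigma>) Fil"
  proof -
    have "((\<lambda>\<iota>. 1 / \<rho> \<iota>) \<longlongrightarrow> 1 / \<sigma>) Fil" using \<sigma> by (intro tendsto_intros \<rho>) auto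
    then have Om: "((\<lambda>\<iota>. Omega (1 / \<rho> \<iota>) 0) \<longlongrightarrow> Omega (1 / \<sigma>) 0) Fil"
      using \<sigma> by (intro isCont_tendsto_compose[OF isCont_Omega]) auto
    have "((\<lambda>\<iota>. inverse (n \<iota>)) \<longlongrightarrow> 0) Fil"
      by (rule tendsto_inverse_0_at_top[OF n])
    then have "((\<lambda>\<iota>. 2 * Omega (1 / \<rho> \<iota>) 0 - (2 / 3 * \<rho> \<iota> + (inverse (n \<iota>))\<^sup>2 / (3 * \<rho> \<iota>)))
       \<longlongrightarrow> 2 * Omega (1 / \<sigma>) 0 - (2 / 3 * \<sigma> + 0\<^sup>2 / (3 * \<sigma>))) Fil"
      using \<sigma> by (intro tendsto_intros \<rho> Om) auto
    then show ?thesis by (simp add: approx_def[abs_def] limit_ratio_def field_simps)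
  qed
  ultimately have "((\<lambda>\<iota>. (ratio \<iota> - approx \<iota>) + approx \<iota>) \<longlongrightarrow> 0 + limit_ratio \<sigma>) Fil"
    by (rule tendsto_add)
  then show "((\<lambda>\<iota>. circle_norm 4 (f \<iota>) ^ 4 / circle_norm 2 (f \<iota>) ^ 4) \<longlongrightarrow> limit_ratio \<sigma>)
             (size_to_infinity I (\<lambda>\<iota>. card (carrier (F \<iota>))))"
    by (simp add: ratio_def Fil_def q_def)
qed

theorem theorem3:
  fixes I :: "'i set"
    and F :: "'i \<Rightarrow> ('a, 'm) ring_scheme"
    and S :: "'i \<Rightarrow> nat set"
    and f :: "'i \<Rightarrow> complex poly"
    and \<sigma> :: real
  shows "((\<forall>\<iota>\<in>I. additive_character_polynomial (F \<iota>) (S \<iota>) (f \<iota>)) \<and> size_stable I F S \<sigma> \<longrightarrow>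
           ((\<lambda>\<iota>. circle_norm 4 (f \<iota>) ^ 4 / circle_norm 2 (f \<iota>) ^ 4) \<longlongrightarrow> limit_ratio \<sigma>)
             (size_to_infinity I (\<lambda>\<iota>. card (carrier (F \<iota>)))))
       \<and> (\<exists>!x::real. x \<in> {1<..<1 + 9/64} \<and> x ^ 3 - 12 * x + 12 = 0)
       \<and> (\<forall>x::real. is_arg_min limit_ratio (\<lambda>\<tau>. \<tau> > 0) x \<longleftrightarrow>
            x \<in> {1<..<1 + 9/64} \<and> x ^ 3 - 12 * x + 12 = 0)"
  using circle_norm_ratio_tendsto[of I F S f \<sigma>] cubic_unique_root is_arg_min_limit_ratio_iff by blast

end
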